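(* Let $m,n\ge 1$ and $r\ge 2$ be integers, let $Y\subseteq X=\{(i,j): 1\le i\le m,\ 1\le j\le n\}$ be a one-sided ladder-shaped region, and let $\underline b=(b_1,\dots,b_r)\in S_r$. Let $P_i=(i,n)$ and $Q_i=(m,b_i)$, $i=1,\dots,r$, be points of $Y$. Then $$t^{-\binom r2}\,\tilde W(n,m;b_1,\dots,b_r)=\sum_{\underline c\in S_r}A(\underline b;\underline c)\,(1-t)^{\sum_{i=1}^r(c_i-b_i)}\,W(n,m;c_1,\dots,c_r),$$ where $\underline c=(c_1,\dots,c_r)$. In particular, if $b_i=i$ for all $i$, then $$t^{-\binom r2}\,\tilde W(n,m;1,\dots,r)=W(n,m;1,\dots,r).$$
   Context: $\mathbb N$ denotes the positive integers and $t$ is an indeterminate. Region and order. $X=\{(i,j): 1\le i\le m, 1\le j\le n\}$ carries the partial order $(i,j)\le(i',j')$ iff $i\ge i'$ and $j\le j'$. A one-sided ladder-shaped region is a subset $Y\subseteq X$ obtained by cutting away a staircase at the upper right corner, i.e. such that $(i,j)\in Y$, $1\le i'\le i$, $1\le j'\le j$ imply $(i',j')\in Y$; it carries the induced order. Paths. For $P\ge Q$ in $Y$, a path from $P$ to $Q$ is a maximal chain in $Y$ with end points $P$ and $Q$ (so going from $P$ to $Q$, each step is $(i,j)\to(i+1,j)$ or $(i,j)\to(i,j-1)$). A corner of a path $C$ is an element $(i,j)\in C$ such that $(i-1,j)\in C$ and $(i,j-1)\in C$. $w_k(P,Q)$ is the number of paths in $Y$ from $P$ to $Q$ with exactly $k$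 corners, and $W(P,Q)=\sum_{k\ge0}w_k(P,Q)t^k$. For points $P_1,\dots,P_r,Q_1,\dots,Q_r$ of $Y$, a family of non-intersecting paths from $P_i$ to $Q_i$ ($i=1,\dots,r$) is $(C_1,\dots,C_r)$ with $C_i$ a path in $Y$ from $P_i$ to $Q_i$ and $C_i\cap C_j=\emptyset$ for $i\ne j$; its number of corners is the sum of the numbers of corners of the $C_i$. $w_k(\mathbf P,\mathbf Q)$ is the number of such families with exactly $k$ corners. For $(b_1,\dots,b_r)$ with $P_i=(i,n)$ and $Q_i=(m,b_i)$ in $Y$: $W(n,m;b_1,\dots,b_r)=\sum_{k\ge 0}w_k(\mathbf P,\mathbf Q)t^k$ and $\tilde W(n,m;b_1,\dots,b_r)=\det[W(P_i,Q_j)]_{i,j=1,\dots,r}$. Index sets. $S_l=\{(b_1,\dots,b_l)\in\mathbb N^l: b_1<b_2<\cdots<b_l\}$. Coefficients $A$. For $l\ge2$ and $\underline b,\underline c\in S_l$, the integer $A(\underline b;\underline c)=A(b_1,\dots,b_l;c_1,\dots,c_l)$ is defined recursively. For $l=2$: $A(b_1,b_2;c_1,c_2)=1$ if $b_2=c_2$ and $b_1\le c_1$, and $0$ otherwise. For $l>2$: $A(\underline b;\underline c)=0$ if $b_l\ne c_l$; if $b_l=c_l$, then $$A(b_1,\dots,b_l;c_1,\dots,c_l)=\sum_{\underline c'}A(b_1,\dots,b_{l-1};c'_1,\dots,c'_{l-1}),$$ the sum being over all $\underline c'\in S_{l-1}$ with $c'_i\le c_i$ for $i=1,\dots,l-1$.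 Since $A(\underline b;\underline c)\neq 0$ forces $c_r=b_r$ and $b_i\le c_i$ for all $i$, only finitely many terms of the sum in the claim are nonzero and in these all points $(m,c_i)$ lie in $Y$; terms with $A(\underline b;\underline c)=0$ are read as $0$. *)

theory Defs
  imports
    "HOL-Computational_Algebra.Polynomial_Factorial"
    "HOL-Library.Groups_Big_Fun"
    "Jordan_Normal_Form.Determinant"
begin

type_synonym point = "nat \<times> nat"

definition rect :: "nat \<Rightarrow> nat \<Rightarrow> point set" where
  "rect m n = {1..m} \<times> {1..n}"

text \<open>The order is reversed in the first coordinate: paths descend from the upper left to the
  lower right.\<close>

definition point_le :: "point \<Rightarrow> point \<Rightarrow> bool" where
  "point_le p q \<longleftrightarrow> fst q \<le> fst p \<and> snd p \<le> snd q"

definition one_sided_ladder :: "nat \<Rightarrow> nat \<Rightarrow> point set \<Rightarrow> bool" where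
  "one_sided_ladder m n Y \<longleftrightarrow> Y \<subseteq> rect m n \<and>
     (\<forall>i j i' j'. (i, j) \<in> Y \<and> 1 \<le> i' \<and> i' \<le> i \<and> 1 \<le> j' \<and> j' \<le> j \<longrightarrow> (i', j') \<in> Y)"

definition chain_between :: "point set \<Rightarrow> point \<Rightarrow> point \<Rightarrow> point set \<Rightarrow> bool" where
  "chain_between Y P Q C \<longleftrightarrow> pred_on.chain Y point_le C \<and> P \<in> C \<and> Q \<in> C \<and>
     (\<forall>x\<in>C. point_le Q x \<and> point_le x P)"

text \<open>Maximality is among the chains with the same end points. If not \<open>point_le Q P\<close>, there are
  no paths from \<open>P\<close> to \<open>Q\<close>.\<close>

definition is_path :: "point set \<Rightarrow> point \<Rightarrow> point \<Rightarrow> point set \<Rightarrow> bool" where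
  "is_path Y P Q C \<longleftrightarrow> chain_between Y P Q C \<and> (\<nexists>D. chain_between Y P Q D \<and> C \<subset> D)"

text \<open>Truncated subtraction is harmless here, since all points of a region have positive
  coordinates.\<close>

definition corners :: "point set \<Rightarrow> point set" where
  "corners C = {(i, j) \<in> C. (i - 1, j) \<in> C \<and> (i, j - 1) \<in> C}"

definition path_count :: "point set \<Rightarrow> nat \<Rightarrow> point \<Rightarrow> point \<Rightarrow> nat" where
  "path_count Y k P Q = card {C. is_path Y P Q C \<and> card (corners C) = k}"

text \<open>The indeterminate \<open>t\<close> is \<open>monom 1 1\<close>. \<open>Sum_any\<close> ranges over all \<open>k\<close>; only finitely many
  terms are nonzero as regions are finite.\<close>

definition path_gf :: "point set \<Rightarrow> point \<Rightarrow> point \<Rightarrow> int poly" where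
  "path_gf Y P Q = Sum_any (\<lambda>k. monom (int (path_count Y k P Q)) k)"

text \<open>Families are lists, so the index \<open>i = 1, \<dots>, r\<close> becomes the list position \<open>i - 1\<close>; the same
  convention is used for the sequences in \<open>inc_seqs\<close> below.\<close>

definition is_family :: "point set \<Rightarrow> point list \<Rightarrow> point list \<Rightarrow> point set list \<Rightarrow> bool" where
  "is_family Y Ps Qs Cs \<longleftrightarrow> length Cs = length Ps \<and>
     (\<forall>i < length Cs. is_path Y (Ps ! i) (Qs ! i) (Cs ! i)) \<and>
     (\<forall>i < length Cs. \<forall>j < length Cs. i \<noteq> j \<longrightarrow> Cs ! i \<inter> Cs ! j = {})"

definition family_count :: "point set \<Rightarrow> nat \<Rightarrow> point list \<Rightarrow> point list \<Rightarrow> nat" where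
  "family_count Y k Ps Qs =
     card {Cs. is_family Y Ps Qs Cs \<and> (\<Sum>C\<leftarrow>Cs. card (corners C)) = k}"

definition start_pts :: "nat \<Rightarrow> nat \<Rightarrow> point list" where
  "start_pts n r = map (\<lambda>i. (i, n)) [1..<Suc r]"

definition end_pts :: "nat \<Rightarrow> nat list \<Rightarrow> point list" where
  "end_pts m b = map (\<lambda>x. (m, x)) b"

definition family_gf :: "point set \<Rightarrow> nat \<Rightarrow> nat \<Rightarrow> nat list \<Rightarrow> int poly" where
  "family_gf Y n m b =
     Sum_any (\<lambda>k. monom (int (family_count Y k (start_pts n (length b)) (end_pts m b))) k)"

definition det_gf :: "point set \<Rightarrow> nat \<Rightarrow> nat \<Rightarrow> nat list \<Rightarrow> int poly" where
  "det_gf Y n m b = det (mat (length b) (length b)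
     (\<lambda>(i, j). path_gf Y (start_pts n (length b) ! i) (end_pts m b ! j)))"

definition inc_seqs :: "nat \<Rightarrow> nat list set" where
  "inc_seqs l = {b. length b = l \<and> 0 \<notin> set b \<and> sorted_wrt (<) b}"

text \<open>The value for \<open>l < 2\<close> is a dummy.\<close>

fun coeff_A :: "nat list \<Rightarrow> nat list \<Rightarrow> int" where
  "coeff_A b c = (let l = length b in
     if l < 2 then 0
     else if l = 2 then (if b ! 1 = c ! 1 \<and> b ! 0 \<le> c ! 0 then 1 else 0)
     else if b ! (l - 1) \<noteq> c ! (l - 1) then 0
     else (\<Sum>c' \<in> {c' \<in> inc_seqs (l - 1). \<forall>i < l - 1. c' ! i \<le> c ! i}. coeff_A (butlast b) c'))"

declare coeff_A.simps [simp del]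

definition tvar :: "int poly fract" where
  "tvar = to_fract (monom 1 1)"

lemma finite_paths:
  assumes "finite Y"
  shows "finite {C. is_path Y P Q C}"
proof (rule finite_subset)
  show "{C. is_path Y P Q C} \<subseteq> Pow Y"
    by (auto simp: is_path_def chain_between_def pred_on.chain_def)
  show "finite (Pow Y)" using assms by simp
qed

lemma finite_path_gf_support:
  assumes "finite Y"
  shows "finite {k. path_count Y k P Q \<noteq> 0}"
proof (rule finite_subset)
  show "{k. path_count Y k P Q \<noteq> 0} \<subseteq> (\<lambda>C. card (corners C)) ` {C. is_path Y P Q C}"
    by (auto simp: path_count_def card_eq_0_iff)
  show "finite ((\<lambda>C. card (corners C)) ` {C. is_path Y P Q C})"
    using finite_paths[OF assms] by simp
qed

lemma finite_families:
  assumes "finite Y"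
  shows "finite {Cs. is_family Y Ps Qs Cs}"
proof (rule finite_subset)
  show "{Cs. is_family Y Ps Qs Cs} \<subseteq> {Cs. set Cs \<subseteq> Pow Y \<and> length Cs = length Ps}"
    by (fastforce simp: is_family_def is_path_def chain_between_def pred_on.chain_def
        in_set_conv_nth)
  show "finite {Cs. set Cs \<subseteq> Pow Y \<and> length Cs = length Ps}"
    by (rule finite_lists_length_eq) (use assms in simp)
qed

lemma finite_family_gf_support:
  assumes "finite Y"
  shows "finite {k. family_count Y k Ps Qs \<noteq> 0}"
proof (rule finite_subset)
  show "{k. family_count Y k Ps Qs \<noteq> 0} \<subseteq>
      (\<lambda>Cs. \<Sum>C\<leftarrow>Cs. card (corners C)) ` {Cs. is_family Y Ps Qs Cs}"
    by (auto simp: family_count_def card_eq_0_iff)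
  show "finite ((\<lambda>Cs. \<Sum>C\<leftarrow>Cs. card (corners C)) ` {Cs. is_family Y Ps Qs Cs})"
    using finite_families[OF assms] by simp
qed

lemma finite_inc_seqs_bounded: "finite {c \<in> inc_seqs l. \<forall>x \<in> set c. x \<le> N}"
proof (rule finite_subset)
  show "{c \<in> inc_seqs l. \<forall>x \<in> set c. x \<le> N} \<subseteq> {c. set c \<subseteq> {..N} \<and> length c = l}"
    by (auto simp: inc_seqs_def)
  show "finite {c. set c \<subseteq> {..N} \<and> length c = l}"
    by (rule finite_lists_length_eq) simp
qed

lemma finite_coeff_A_index: "finite {c' \<in> inc_seqs l. \<forall>i < l. c' ! i \<le> (c ! i :: nat)}"
proof (rule finite_subset[OF _ finite_inc_seqs_bounded])
  show "{c' \<in> inc_seqs l. \<forall>i < l. c' ! i \<le> c ! i} \<subseteq>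
      {c' \<in> inc_seqs l. \<forall>x \<in> set c'. x \<le> (\<Sum>i<l. c ! i)}"
    using member_le_sum[of _ "{..<l}" "\<lambda>i. c ! i"]
    by (fastforce simp: inc_seqs_def in_set_conv_nth intro: order_trans)
qed

lemma finite_coeff_A_support:
  assumes "2 \<le> l" and "b \<in> inc_seqs l"
  shows "finite {c \<in> inc_seqs l. coeff_A b c \<noteq> 0}"
proof (rule finite_subset[OF _ finite_inc_seqs_bounded])
  show "{c \<in> inc_seqs l. coeff_A b c \<noteq> 0} \<subseteq> {c \<in> inc_seqs l. \<forall>x \<in> set c. x \<le> b ! (l - 1)}"
  proof safe
    fix c x assume c: "c \<in> inc_seqs l" and nz: "coeff_A b c \<noteq> 0" and x: "x \<in> set c"
    have lb: "length b = l" and lc: "length c = l" and sc: "sorted_wrt (<) c"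
      using assms c by (auto simp: inc_seqs_def)
    have last: "b ! (l - 1) = c ! (l - 1)"
      using nz lb assms(1)
      by (subst (asm) coeff_A.simps) (auto simp: Let_def numeral_2_eq_2 split: if_splits)
    obtain i where i: "i < l" "x = c ! i"
      using x lc by (auto simp: in_set_conv_nth)
    have "c ! i \<le> c ! (l - 1)"
      using sorted_wrt_nth_less[OF sc, of i "l - 1"] i lc
      by (cases "i = l - 1") (auto intro: less_imp_le)
    then show "x \<le> b ! (l - 1)" using i last by simp
  qed
qed

end

theory Submission
  imports Defs
begin

text \<open>
  Write \<open>u = 1 - t\<close>. Both sides of the identity are computed by sweeping the ladder row by row, and
  the coefficients \<open>A\<close> turn out to be the entries of an operator that intertwines the two sweeps.

  A path that enters a row from the previous one in column \<open>p\<close> runs to some column \<open>x \<le> p\<close> and leaves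
  the row there; it has a corner in that row exactly when \<open>x < p\<close>. For a non-intersecting family this gives the transfer
  operator \<open>w\<close> (\<open>row_weight\<close>): the segments in the row have to be disjoint, which is the condition
  \<open>interlacing\<close>, and each non-degenerate segment costs a factor \<open>t\<close>. For the determinant, the column
  vectors are multiplied by the one-path transfer matrix, which is \<open>(1 - u S) E\<close> with \<open>E\<close> the summation
  over all columns from a given one on and \<open>S\<close> the shift by one column. The minors of \<open>E\<close> are the indicators of
  \<open>interlacing\<close>, and those of \<open>1 - u S\<close> are given by an operator \<open>D\<close> (\<open>diff_weight\<close>). So the determinant
  is swept by \<open>E D\<close> and the family count by \<open>w\<close>, where the same letter \<open>E\<close> now denotes \<open>interlacing\<close>.

  Let \<open>J\<close> (\<open>lower\<close>) move all entries of a tuple to the left independently, with a factor \<open>u\<close> per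
  step, and let \<open>K\<close> (\<open>A_kernel\<close>) have the entries \<open>A(b;c) u^(sum c - sum b)\<close>. The recursion for
  \<open>A\<close> says that \<open>K\<close> keeps the largest entry and acts on the others as \<open>J K\<close>. Induction on the number
  of entries gives \<open>K E = w J K\<close> (lemma \<open>A_kernel_interlacing\<close>) and, on decreasing tuples, \<open>J K D = K\<close> (lemma
  \<open>lower_A_kernel_diff_weight\<close>). The first rests on \<open>w J = J w\<close>, which holds because both products
  are products of independent telescoping sums. Together they yield \<open>K E D = w K\<close> (lemma
  \<open>A_kernel_intertwines\<close>), which is the claimed identity as far as the step from one row to the next is
  concerned. The boundary of the ladder forbids in each row the columns beyond a certain one, a
  condition on the largest entry alone; since \<open>K\<close> keeps the largest entry, it commutes with this
  restriction. This is why a ladder on one side is harmless.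

  The starting points lie in different rows, so the sweep has to begin in row \<open>r\<close>, all of whose columns
  belong to the ladder. On a full row the one-path transfer is \<open>u + t E\<close>. Row operations therefore
  extract the factor \<open>t^(0 + 1 + \<dots> + (r - 1))\<close>, the origin of the power of \<open>t\<close> in the theorem, and leave
  the determinant of the vectors \<open>E^(s + 1) \<delta>\<close>, where \<open>\<delta>\<close> is concentrated in column \<open>n\<close>. This determinant
  obeys a recursion in \<open>r\<close> that sums over interlacing tuples, and by \<open>K E = w J K\<close> the families
  weighted with \<open>K\<close> obey the same recursion as paths enter one after the other (lemma
  \<open>row_families_gf_A_kernel_first_rows\<close>).

  Tuples are written with the largest entry first, that is, in the reverse of the order in which the
  theorem lists them, so that removing the head of a list is what the recursion for \<open>A\<close> does.
\<close>

section \<open>Decreasing tuples and interlacing\<close>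

text \<open>Bounding the entries by the width \<open>n\<close> of the region makes every operator below a finite matrix, so
  that products of operators are iterated sums over one fixed set.\<close>
definition tuples :: "nat \<Rightarrow> nat \<Rightarrow> nat list set" where
  "tuples n k = {c. length c = k \<and> set c \<subseteq> {1..n}}"

abbreviation dec :: "nat list \<Rightarrow> bool" where
  "dec \<equiv> sorted_wrt (>)"

lemma tuples_0: "tuples n 0 = {[]}"
  by (auto simp: tuples_def)

lemma Cons_in_tuples_iff: "x # c \<in> tuples n (Suc k) \<longleftrightarrow> x \<in> {1..n} \<and> c \<in> tuples n k"
  by (auto simp: tuples_def)

lemma length_tuples: "c \<in> tuples n k \<Longrightarrow> length c = k"
  by (simp add: tuples_def)

lemma nth_tuples: "c \<in> tuples n k \<Longrightarrow> j < k \<Longrightarrow> c ! j \<in> {1..n}"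
  unfolding tuples_def using nth_mem[of j c] by blast

lemma tuples_Suc: "tuples n (Suc k) = (\<lambda>(x, c). x # c) ` ({1..n} \<times> tuples n k)"
  by (force simp: tuples_def image_def length_Suc_conv)

lemma finite_tuples [simp]: "finite (tuples n k)"
  using finite_lists_length_eq[of "{1..n}" k] by (simp add: tuples_def conj_commute)

lemma sum_tuples_Suc:
  "(\<Sum>c\<in>tuples n (Suc k). f c) = (\<Sum>x\<in>{1..n}. \<Sum>c\<in>tuples n k. f (x # c))"
  unfolding tuples_Suc by (subst sum.reindex) (auto simp: inj_on_def sum.cartesian_product split_def)

lemma sum_mult_if_const:
  fixes q :: "'a :: comm_ring_1"
  shows "(\<Sum>x\<in>A. q * (if P then f x else 0)) = q * (if P then sum f A else 0)"
  by (simp add: sum_distrib_left)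

text \<open>If \<open>a\<close> lists the columns in which disjoint segments of a row are entered and \<open>b\<close> those in which they
  are left, then \<open>interlacing a b\<close> says that the segments, from right to left, do not meet:
  \<open>\<dots> a\<^sub>2 < b\<^sub>1 \<le> a\<^sub>1\<close>.\<close>
fun interlacing :: "nat list \<Rightarrow> nat list \<Rightarrow> bool" where
  "interlacing [] [] = True"
| "interlacing (x # a) (y # b) = (y \<le> x \<and> (\<forall>z\<in>set a. z < y) \<and> interlacing a b)"
| "interlacing _ _ = False"

lemma interlacing_dec_left: "interlacing a b \<Longrightarrow> dec a"
  by (induction a b rule: interlacing.induct) auto

lemma interlacing_bound: "interlacing a b \<Longrightarrow> (\<And>z. z \<in> set a \<Longrightarrow> z < y) \<Longrightarrow> z \<in> set b \<Longrightarrow> z < y"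
  by (induction a b arbitrary: z rule: interlacing.induct) force+

lemma interlacing_dec_right: "interlacing a b \<Longrightarrow> dec b"
proof (induction a b rule: interlacing.induct)
  case (2 x a y b)
  then show ?case using interlacing_bound[of a b y] by auto
qed auto

lemma interlacing_iff_nth:
  "interlacing a b \<longleftrightarrow> length a = length b \<and> (\<forall>i<length b. b ! i \<le> a ! i) \<and>
     (\<forall>i j. i < j \<longrightarrow> j < length b \<longrightarrow> a ! j < b ! i)"
proof (induction a b rule: interlacing.induct)
  case (2 x a y b)
  have "(\<forall>i j. i < j \<longrightarrow> j < length (y # b) \<longrightarrow> (x # a) ! j < (y # b) ! i) \<longleftrightarrow>
      (\<forall>j<length b. a ! j < y) \<and> (\<forall>i j. i < j \<longrightarrow> j < length b \<longrightarrow> a ! j < b ! i)"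
    (is "?l \<longleftrightarrow> ?r")
  proof
    assume l: ?l
    show ?r
    proof (intro conjI allI impI)
      fix j assume "j < length b"
      with l[rule_format, of 0 "Suc j"] show "a ! j < y" by simp
    next
      fix i j assume "i < j" "j < length b"
      with l[rule_format, of "Suc i" "Suc j"] show "a ! j < b ! i" by simp
    qed
  next
    assume ?r
    then show ?l by (auto simp: nth_Cons split: nat.splits)
  qed
  then show ?case using 2 by (auto simp: All_less_Suc2 all_set_conv_all_nth)
qed auto

context
  fixes t :: "'a :: comm_ring_1" and n :: nat
begin

fun lower :: "nat list \<Rightarrow> nat list \<Rightarrow> 'a" where
  "lower [] [] = 1"
| "lower (x # a) (p # e) = (if p \<le> x then (1 - t) ^ (x - p) * lower a e else 0)"
| "lower _ _ = 0"

text \<open>The factor of a segment is \<open>t\<close> exactly when the segment contains a corner.\<close>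
fun row_weight :: "nat list \<Rightarrow> nat list \<Rightarrow> 'a" where
  "row_weight [] [] = 1"
| "row_weight (x # a) (y # b) =
     (if y \<le> x \<and> (\<forall>z\<in>set a. z < y) then (if y = x then 1 else t) * row_weight a b else 0)"
| "row_weight _ _ = 0"

text \<open>Up to a power of \<open>1 - t\<close> these are the coefficients \<open>A\<close>; see \<open>A_kernel_eq_coeff_A\<close> below. The
  decreasing order of the first argument is built in, and it implies that of the second.\<close>
fun A_kernel :: "nat list \<Rightarrow> nat list \<Rightarrow> 'a" where
  "A_kernel [] [] = 1"
| "A_kernel (x # a) (y # b) =
     (if x = y \<and> dec (x # a) then \<Sum>e\<in>tuples n (length a). lower a e * A_kernel e b else 0)"
| "A_kernel _ _ = 0"

text \<open>For decreasing tuples this is the minor with rows \<open>c\<close> and columns \<open>d\<close> of the matrix that takes a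
  function \<open>f\<close> to \<open>f x - (1 - t) f (x + 1)\<close>.\<close>
fun diff_weight :: "nat list \<Rightarrow> nat list \<Rightarrow> 'a" where
  "diff_weight [] [] = 1"
| "diff_weight (x # c) (y # d) =
     (if x = y then 1 else if x = Suc y then - (1 - t) else 0) * diff_weight c d"
| "diff_weight _ _ = 0"

text \<open>The common closed form of \<open>row_weight\<close> after \<open>lower\<close> and of \<open>lower\<close> after \<open>row_weight\<close>: one
  factor for each pair of an entry \<open>y\<close> of \<open>b\<close> and the next smaller entry \<open>z\<close> of \<open>a\<close>, with truncated
  subtraction giving the factor \<open>1\<close> to pairs with \<open>z < y\<close>.\<close>
fun overlap :: "nat list \<Rightarrow> nat list \<Rightarrow> 'a" where
  "overlap [] [] = 1"
| "overlap (x # a) (y # b) =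
     (if y \<le> x then (case a of [] \<Rightarrow> 1 | z # _ \<Rightarrow> (1 - t) ^ (Suc z - y)) * overlap a b else 0)"
| "overlap _ _ = 0"

lemma row_weight_zero: "\<not> interlacing a b \<Longrightarrow> row_weight a b = 0"
  by (induction a b rule: interlacing.induct) auto

lemma A_kernel_nonzero_dec: "A_kernel a b \<noteq> 0 \<Longrightarrow> dec a"
  by (cases a; cases b) (auto split: if_splits)

lemma lower_nonzero: "lower a e \<noteq> 0 \<Longrightarrow> list_all2 (\<le>) e a"
  by (induction a e rule: lower.induct) (force split: if_splits)+

lemma A_kernel_nonzero:
  "A_kernel a b \<noteq> 0 \<Longrightarrow> dec b \<and> list_all2 (\<le>) b a \<and> (b \<noteq> [] \<longrightarrow> hd b = hd a)"
proof (induction b arbitrary: a)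
  case Nil
  then show ?case by (cases a) auto
next
  case (Cons y b)
  then obtain a' where a: "a = y # a'" and dec: "dec (y # a')"
    by (cases a) (auto split: if_splits)
  with Cons.prems have "(\<Sum>e\<in>tuples n (length a'). lower a' e * A_kernel e b) \<noteq> 0" by auto
  then obtain e where e: "lower a' e \<noteq> 0" "A_kernel e b \<noteq> 0"
    by (metis (no_types, lifting) mult_zero_left mult_zero_right sum.neutral)
  from Cons.IH[OF e(2)] lower_nonzero[OF e(1)]
  have b: "dec b" "list_all2 (\<le>) b a'"
    by (auto intro: list_all2_trans[where ?P1.0 = "(\<le>)" and ?P2.0 = "(\<le>)" and bs = e])
  have "z < y" if "z \<in> set b" for z
  proof -
    from that obtain i where "i < length b" "z = b ! i" by (auto simp: in_set_conv_nth)
    with b(2) have "z \<le> a' ! i" "i < length a'" by (auto simp: list_all2_conv_all_nth)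
    with dec show ?thesis by (auto intro: le_less_trans)
  qed
  with b a show ?case by auto
qed

text \<open>Both tuples have the same largest entry. This transports every upper bound on the entries through
  the operator, in particular the bound that the ladder imposes in a row.\<close>
lemma A_kernel_bound_iff:
  assumes "A_kernel a b \<noteq> 0"
  shows "(\<forall>z\<in>set a. z < y) \<longleftrightarrow> (\<forall>z\<in>set b. z < y)"
proof (cases b)
  case Nil
  with A_kernel_nonzero[OF assms] show ?thesis by auto
next
  case (Cons p b')
  with A_kernel_nonzero[OF assms] obtain a' where "a = p # a'" by (cases a) auto
  with A_kernel_nonzero[OF assms] A_kernel_nonzero_dec[OF assms] Cons show ?thesis by force
qed

text \<open>Since \<open>t (1 - t)^k = (1 - t)^k - (1 - t)^(k + 1)\<close>, this sum and the next one telescope.\<close>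
lemma geometric_down:
  assumes "y \<le> M" "M \<le> x"
  shows "(\<Sum>p=y..M. (1 - t) ^ (x - p) * (if y = p then 1 else t)) = (1 - t) ^ (x - M)"
  using assms
proof (induction M rule: dec_induct)
  case base
  then show ?case by simp
next
  case (step M)
  have "(\<Sum>p=y..Suc M. (1 - t) ^ (x - p) * (if y = p then 1 else t)) =
     (1 - t) ^ (x - M) + (1 - t) ^ (x - Suc M) * t"
    using step by (simp add: sum.cl_ivl_Suc)
  also have "x - M = Suc (x - Suc M)" using step by simp
  finally show ?case by (simp add: algebra_simps)
qed

lemma geometric_up:
  assumes "y \<le> M" "M \<le> x"
  shows "(\<Sum>p=M..x. (if p = x then 1 else t) * (1 - t) ^ (p - y)) = (1 - t) ^ (M - y)"
  using assms(2,1)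
proof (induction M rule: inc_induct)
  case base
  then show ?case by simp
next
  case (step M)
  have "{M..x} = insert M {Suc M..x}" using step by auto
  then have "(\<Sum>p=M..x. (if p = x then 1 else t) * (1 - t) ^ (p - y)) =
     t * (1 - t) ^ (M - y) + (1 - t) ^ (Suc M - y)"
    using step by simp
  also have "Suc M - y = Suc (M - y)" using step by simp
  finally show ?case by (simp add: algebra_simps)
qed

text \<open>For given \<open>a\<close> and \<open>b\<close> the entries of the intermediate tuple vary independently: each lies
  strictly above the next entry of \<open>a\<close> and between the entries of \<open>b\<close> and \<open>a\<close> in its own place. Each of
  the sums telescopes.\<close>
lemma row_weight_lower:
  assumes "a \<in> tuples n k" "b \<in> tuples n k" "dec a"
  shows "(\<Sum>d\<in>tuples n k. row_weight a d * lower d b) = overlap a b"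
  using assms
proof (induction k arbitrary: a b)
  case 0
  then show ?case by (simp add: tuples_0)
next
  case (Suc k)
  then obtain x a' y b' where ab: "a = x # a'" "b = y # b'"
    and x: "x \<in> {1..n}" "a' \<in> tuples n k" and y: "y \<in> {1..n}" "b' \<in> tuples n k" and "dec a'"
    by (auto simp: tuples_Suc)
  \<comment> \<open>the smallest value of the first entry of the intermediate tuple\<close>
  define M where "M = (case a' of [] \<Rightarrow> y | z # _ \<Rightarrow> max y (Suc z))"
  have M: "(p \<le> x \<and> (\<forall>z\<in>set a'. z < p) \<and> y \<le> p) \<longleftrightarrow> M \<le> p \<and> p \<le> x" for p
    using \<open>dec a'\<close> by (cases a') (auto simp: M_def)
  have "(\<Sum>d\<in>tuples n (Suc k). row_weight a d * lower d b) =
     (\<Sum>p\<in>{1..n}. \<Sum>d\<in>tuples n k. row_weight a (p # d) * lower (p # d) b)"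
    by (rule sum_tuples_Suc)
  also have "\<dots> = (\<Sum>p\<in>{1..n}. if M \<le> p \<and> p \<le> x then
      ((if p = x then 1 else t) * (1 - t) ^ (p - y)) * overlap a' b' else 0)"
  proof (rule sum.cong[OF refl])
    fix p
    show "(\<Sum>d\<in>tuples n k. row_weight a (p # d) * lower (p # d) b) =
      (if M \<le> p \<and> p \<le> x then ((if p = x then 1 else t) * (1 - t) ^ (p - y)) * overlap a' b' else 0)"
    proof -
      have "row_weight a (p # d) * lower (p # d) b = (if M \<le> p \<and> p \<le> x then
          ((if p = x then 1 else t) * (1 - t) ^ (p - y)) * (row_weight a' d * lower d b') else 0)" for d
        unfolding M[symmetric] ab by auto
      then show ?thesis
        by (cases "M \<le> p"; cases "p \<le> x")
          (simp_all add: Suc.IH[OF x(2) y(2) \<open>dec a'\<close>, symmetric] sum_distrib_left)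
    qed
  qed
  also have "\<dots> = (\<Sum>p=M..x. (if p = x then 1 else t) * (1 - t) ^ (p - y)) * overlap a' b'"
    unfolding sum_distrib_right
    by (rule sum.mono_neutral_cong_right) (use x y in \<open>auto simp: M_def split: list.splits\<close>)
  also have "\<dots> = overlap a b"
  proof (cases "y \<le> x")
    case True
    then have "M \<le> x" "y \<le> M" using Suc.prems(3) ab by (auto simp: M_def split: list.splits)
    moreover have "(1 - t) ^ (M - y) = (case a' of [] \<Rightarrow> 1 | z # _ \<Rightarrow> (1 - t) ^ (Suc z - y))"
      by (cases a') (auto simp: M_def max_def)
    ultimately show ?thesis using True by (simp add: geometric_up ab)
  next
    case False
    then have "{M..x} = {}" by (auto simp: M_def split: list.splits)
    then show ?thesis using False by (simp add: ab)
  qed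
  finally show ?case .
qed

text \<open>Here too the intermediate entries vary independently, each being bounded from above by the
  preceding entry of \<open>b\<close>. The bound \<open>y\<close> takes the place of the entry that precedes the first one, and the
  factor in front of \<open>overlap\<close> is the one that \<open>overlap (x # a) (y # b)\<close> contains. This is why the product
  agrees with the one in the opposite order.\<close>
lemma lower_row_weight_capped:
  assumes "a \<in> tuples n k" "b \<in> tuples n k" "dec a" "dec b" "\<forall>z\<in>set b. z < y"
  shows "(\<Sum>e\<in>{e \<in> tuples n k. \<forall>z\<in>set e. z < y}. lower a e * row_weight e b) =
     (case a of [] \<Rightarrow> 1 | z # _ \<Rightarrow> (1 - t) ^ (Suc z - y)) * overlap a b"
  using assms
proof (induction k arbitrary: a b y)
  case 0
  then show ?case by (simp add: tuples_0 Collect_conv_if conj_commute cong: conj_cong)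
next
  case (Suc k)
  then obtain x a' v b' where ab: "a = x # a'" "b = v # b'"
    and x: "x \<in> {1..n}" "a' \<in> tuples n k" "dec a'" and v: "v \<in> {1..n}" "b' \<in> tuples n k" "dec b'"
      "\<forall>z\<in>set b'. z < v" and vy: "v < y"
    by (auto simp: tuples_Suc)
  define R where "R = (\<Sum>e\<in>{e \<in> tuples n k. \<forall>z\<in>set e. z < v}. lower a' e * row_weight e b')"
  have R: "R = (case a' of [] \<Rightarrow> 1 | z # _ \<Rightarrow> (1 - t) ^ (Suc z - v)) * overlap a' b'"
    unfolding R_def using x v by (intro Suc.IH) auto
  have "(\<Sum>e\<in>{e \<in> tuples n (Suc k). \<forall>z\<in>set e. z < y}. lower a e * row_weight e b) =
     (\<Sum>e\<in>tuples n (Suc k). if \<forall>z\<in>set e. z < y then lower a e * row_weight e b else 0)"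
    by (simp add: sum.inter_filter)
  also have "\<dots> = (\<Sum>p\<in>{1..n}. if v \<le> p \<and> p \<le> min x (y - 1) then
      ((1 - t) ^ (x - p) * (if v = p then 1 else t)) * R else 0)"
    unfolding sum_tuples_Suc
  proof (rule sum.cong[OF refl])
    fix p
    have "(\<Sum>e\<in>tuples n k. if \<forall>z\<in>set (p # e). z < y then lower a (p # e) * row_weight (p # e) b else 0) =
        (\<Sum>e\<in>tuples n k. if \<forall>z\<in>set e. z < v then
           (if v \<le> p \<and> p \<le> min x (y - 1) then (1 - t) ^ (x - p) * (if v = p then 1 else t) else 0)
             * (lower a' e * row_weight e b') else 0)"
      using vy by (intro sum.cong refl) (auto simp: ab)
    also have "\<dots> = (if v \<le> p \<and> p \<le> min x (y - 1) then
        ((1 - t) ^ (x - p) * (if v = p then 1 else t)) * R else 0)"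
      unfolding R_def by (simp add: sum.inter_filter[symmetric] sum_distrib_left)
    finally show "(\<Sum>e\<in>tuples n k. if \<forall>z\<in>set (p # e). z < y
        then lower a (p # e) * row_weight (p # e) b else 0) = \<dots>" .
  qed
  also have "\<dots> = (\<Sum>p=v..min x (y - 1). (1 - t) ^ (x - p) * (if v = p then 1 else t)) * R"
    unfolding sum_distrib_right
    by (rule sum.mono_neutral_cong_right) (use x v in auto)
  also have "\<dots> = (1 - t) ^ (Suc x - y) * overlap a b"
  proof (cases "v \<le> x")
    case True
    then have "v \<le> min x (y - 1)" using vy by simp
    then have "(\<Sum>p=v..min x (y - 1). (1 - t) ^ (x - p) * (if v = p then 1 else t)) =
      (1 - t) ^ (x - min x (y - 1))" by (intro geometric_down) auto
    also have "x - min x (y - 1) = Suc x - y" using vy by auto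
    finally show ?thesis using True R by (simp add: ab mult_ac)
  next
    case False
    then show ?thesis by (simp add: ab)
  qed
  finally show ?case by (simp add: ab)
qed

text \<open>In both products the largest entries \<open>x\<close> and \<open>y\<close> of \<open>a\<close> and \<open>b\<close> are split off. On the left,
  interlacing bounds the remaining entries of the middle tuple by \<open>y\<close>, and this bound moves through
  \<open>A_kernel\<close>. On the right, \<open>row_weight\<close> followed by \<open>lower\<close> is rewritten in the opposite order, where the
  same bound appears.\<close>
lemma A_kernel_interlacing:
  assumes "a \<in> tuples n k" "b \<in> tuples n k"
  shows "(\<Sum>c\<in>tuples n k. A_kernel a c * of_bool (interlacing c b)) =
    (\<Sum>d\<in>tuples n k. \<Sum>e\<in>tuples n k. row_weight a d * lower d e * A_kernel e b)"
  using assms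
proof (induction k arbitrary: a b)
  case 0
  then show ?case by (simp add: tuples_0)
next
  case (Suc k)
  show ?case
  proof (cases "dec a")
    case False
    then have "A_kernel a c = 0" "row_weight a c = 0" for c
      using A_kernel_nonzero_dec row_weight_zero interlacing_dec_left by blast+
    then show ?thesis by simp
  next
    case dec: True
    from Suc.prems obtain x a' y b' where ab: "a = x # a'" "b = y # b'"
      and x: "x \<in> {1..n}" "a' \<in> tuples n k" and y: "y \<in> {1..n}" "b' \<in> tuples n k"
      by (auto simp: tuples_Suc)
    have len: "length a' = k" using x by (simp add: tuples_def)
    define S where "S = (\<Sum>e\<in>{e \<in> tuples n k. \<forall>z\<in>set e. z < y}. lower a' e *
       (\<Sum>d\<in>tuples n k. \<Sum>g\<in>tuples n k. row_weight e d * lower d g * A_kernel g b'))"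
    have "(\<Sum>c\<in>tuples n (Suc k). A_kernel a c * of_bool (interlacing c b)) =
        (\<Sum>p\<in>{1..n}. if p = x then \<Sum>c\<in>tuples n k. A_kernel a (x # c) * of_bool (interlacing (x # c) b) else 0)"
      unfolding sum_tuples_Suc by (intro sum.cong refl) (auto simp: ab)
    also have "\<dots> = (\<Sum>c\<in>tuples n k. A_kernel a (x # c) * of_bool (interlacing (x # c) b))"
      using x by simp
    also have "\<dots> = (\<Sum>c\<in>tuples n k. \<Sum>e\<in>tuples n k. of_bool (y \<le> x) *
        (if \<forall>z\<in>set e. z < y then lower a' e * (A_kernel e c * of_bool (interlacing c b')) else 0))"
    proof (rule sum.cong[OF refl])
      fix c
      have "A_kernel a (x # c) * of_bool (interlacing (x # c) b) =
        (\<Sum>e\<in>tuples n k. (lower a' e * A_kernel e c) * of_bool (interlacing (x # c) b))"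
        unfolding sum_distrib_right[symmetric] using dec by (simp add: ab len del: interlacing.simps)
      also have "\<dots> = (\<Sum>e\<in>tuples n k. of_bool (y \<le> x) *
        (if \<forall>z\<in>set e. z < y then lower a' e * (A_kernel e c * of_bool (interlacing c b')) else 0))"
      proof (rule sum.cong[OF refl])
        fix e
        show "(lower a' e * A_kernel e c) * of_bool (interlacing (x # c) b) = of_bool (y \<le> x) *
            (if \<forall>z\<in>set e. z < y then lower a' e * (A_kernel e c * of_bool (interlacing c b')) else 0)"
          using A_kernel_bound_iff[of e c y] by (cases "A_kernel e c = 0") (auto simp: ab)
      qed
      finally show "A_kernel a (x # c) * of_bool (interlacing (x # c) b) = \<dots>" .
    qed
    also have "\<dots> = of_bool (y \<le> x) * (\<Sum>e\<in>tuples n k. if \<forall>z\<in>set e. z < y then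
        lower a' e * (\<Sum>c\<in>tuples n k. A_kernel e c * of_bool (interlacing c b')) else 0)"
    proof (subst sum.swap, subst sum_distrib_left, rule sum.cong[OF refl])
      fix e
      show "(\<Sum>c\<in>tuples n k. of_bool (y \<le> x) *
          (if \<forall>z\<in>set e. z < y then lower a' e * (A_kernel e c * of_bool (interlacing c b')) else 0)) =
        of_bool (y \<le> x) * (if \<forall>z\<in>set e. z < y then
          lower a' e * (\<Sum>c\<in>tuples n k. A_kernel e c * of_bool (interlacing c b')) else 0)"
        unfolding sum_distrib_left[of "lower a' e"] by (rule sum_mult_if_const)
    qed
    also have "\<dots> = of_bool (y \<le> x) * S"
    proof -
      have "(\<Sum>e\<in>tuples n k. if \<forall>z\<in>set e. z < y then
          lower a' e * (\<Sum>c\<in>tuples n k. A_kernel e c * of_bool (interlacing c b')) else 0) = S"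
        unfolding S_def sum.inter_filter[OF finite_tuples]
        by (intro sum.cong refl if_cong arg_cong[where f = "\<lambda>s. _ * s"] Suc.IH y(2))
      then show ?thesis by (rule arg_cong)
    qed
    also have "\<dots> = (\<Sum>g\<in>tuples n k. of_bool (y \<le> x) *
      (\<Sum>e\<in>{e \<in> tuples n k. \<forall>z\<in>set e. z < y}. lower a' e * row_weight e g) *
        (\<Sum>h\<in>tuples n k. lower g h * A_kernel h b'))"
    proof -
      define H where "H g = (\<Sum>h\<in>tuples n k. lower g h * A_kernel h b')" for g
      have "S = (\<Sum>e\<in>{e \<in> tuples n k. \<forall>z\<in>set e. z < y}. \<Sum>g\<in>tuples n k.
          lower a' e * row_weight e g * H g)"
        unfolding S_def H_def by (simp add: sum_distrib_left mult.assoc)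
      also have "\<dots> = (\<Sum>g\<in>tuples n k. (\<Sum>e\<in>{e \<in> tuples n k. \<forall>z\<in>set e. z < y}.
          lower a' e * row_weight e g) * H g)"
        by (subst sum.swap) (simp add: sum_distrib_right)
      finally have "of_bool (y \<le> x) * S = of_bool (y \<le> x) * \<dots>" by (rule arg_cong)
      then show ?thesis
        unfolding H_def sum_distrib_left[of "of_bool (y \<le> x)" _ "tuples n k"] mult.assoc .
    qed
    also have "\<dots> = (\<Sum>g\<in>tuples n k. overlap a (y # g) * A_kernel (y # g) b)"
    proof (rule sum.cong[OF refl])
      fix g assume g: "g \<in> tuples n k"
      show "of_bool (y \<le> x) *
        (\<Sum>e\<in>{e \<in> tuples n k. \<forall>z\<in>set e. z < y}. lower a' e * row_weight e g) *
        (\<Sum>h\<in>tuples n k. lower g h * A_kernel h b') = overlap a (y # g) * A_kernel (y # g) b"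
      proof (cases "dec (y # g)")
        case True
        then show ?thesis using lower_row_weight_capped[of a' k g y] dec x g
          by (auto simp: ab tuples_def)
      next
        case False
        have "lower a' e * row_weight e g = 0" if "\<forall>z\<in>set e. z < y" for e
        proof (cases "interlacing e g")
          case True
          with that have "dec (y # g)" using interlacing_dec_right[of e g] interlacing_bound[of e g y] by auto
          with False show ?thesis by simp
        qed (simp add: row_weight_zero)
        then have "(\<Sum>e\<in>{e \<in> tuples n k. \<forall>z\<in>set e. z < y}. lower a' e * row_weight e g) = 0"
          by (intro sum.neutral) auto
        moreover have "A_kernel (y # g) b = 0" using False A_kernel_nonzero_dec by blast
        ultimately show ?thesis by simp
      qed
    qed
    also have "\<dots> = (\<Sum>p\<in>{1..n}. if p = y then \<Sum>g\<in>tuples n k. overlap a (p # g) * A_kernel (p # g) b else 0)"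
      using y by simp
    also have "\<dots> = (\<Sum>g\<in>tuples n (Suc k). overlap a g * A_kernel g b)"
      unfolding sum_tuples_Suc by (intro sum.cong refl) (auto simp: ab)
    also have "\<dots> = (\<Sum>g\<in>tuples n (Suc k). \<Sum>d\<in>tuples n (Suc k). row_weight a d * lower d g * A_kernel g b)"
      using dec Suc.prems by (intro sum.cong refl) (simp add: row_weight_lower[symmetric] sum_distrib_right)
    also have "\<dots> = (\<Sum>d\<in>tuples n (Suc k). \<Sum>e\<in>tuples n (Suc k). row_weight a d * lower d e * A_kernel e b)"
      by (rule sum.swap)
    finally show ?thesis .
  qed
qed

text \<open>The first entry of the tuple on which \<open>A_kernel\<close> acts is either \<open>y\<close> or \<open>y + 1\<close>, and the two
  contributions \<open>u^(x - y)\<close> and \<open>- u u^(x - y - 1)\<close> cancel unless \<open>x = y\<close>. What remains is the recursion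
  for \<open>A_kernel\<close>.\<close>
lemma lower_A_kernel_diff_weight:
  assumes "a \<in> tuples n k" "b \<in> tuples n k" "dec a" "dec b"
  shows "(\<Sum>e\<in>tuples n k. \<Sum>c\<in>tuples n k. lower a e * A_kernel e c * diff_weight c b) = A_kernel a b"
  using assms
proof (induction k arbitrary: a b)
  case 0
  then show ?case by (simp add: tuples_0)
next
  case (Suc k)
  from Suc.prems obtain x a' y b' where ab: "a = x # a'" "b = y # b'"
    and x: "x \<in> {1..n}" "a' \<in> tuples n k" "dec a'" and y: "y \<in> {1..n}" "b' \<in> tuples n k" "dec b'"
    by (auto simp: tuples_Suc)
  have len: "length a' = k" using x by (simp add: tuples_def)
  \<comment> \<open>the part of the summand that depends on the first entry \<open>p\<close> only\<close>
  define s where "s p = (if p \<le> x then (1 - t) ^ (x - p) *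
     (if p = y then 1 else if p = Suc y then - (1 - t) else 0) else 0)" for p
  define R where "R = (\<Sum>e\<in>tuples n k. lower a' e * A_kernel e b')"
  have inner: "(\<Sum>c\<in>tuples n (Suc k). lower a (p # e) * A_kernel (p # e) c * diff_weight c b) =
      s p * (lower a' e * A_kernel e b')" if p: "p \<in> {1..n}" and e: "e \<in> tuples n k" for p e
  proof (cases "dec (p # e)")
    case True
    then have "dec e" by simp
    have lene: "length e = k" using e by (simp add: tuples_def)
    have "(\<Sum>c\<in>tuples n (Suc k). lower a (p # e) * A_kernel (p # e) c * diff_weight c b) =
      (\<Sum>q\<in>{1..n}. if q = p then
        \<Sum>c\<in>tuples n k. lower a (p # e) * A_kernel (p # e) (p # c) * diff_weight (p # c) b else 0)"
      unfolding sum_tuples_Suc by (intro sum.cong refl) auto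
    also have "\<dots> = (\<Sum>c\<in>tuples n k. lower a (p # e) * A_kernel (p # e) (p # c) * diff_weight (p # c) b)"
      using p by simp
    also have "\<dots> = (\<Sum>c\<in>tuples n k. s p * lower a' e *
       ((\<Sum>g\<in>tuples n k. lower e g * A_kernel g c) * diff_weight c b'))"
      using True by (intro sum.cong refl) (auto simp: ab s_def lene)
    also have "\<dots> = s p * lower a' e * (\<Sum>g\<in>tuples n k. \<Sum>c\<in>tuples n k. lower e g * A_kernel g c * diff_weight c b')"
      unfolding sum_distrib_left[symmetric] sum_distrib_right by (subst sum.swap) simp
    also have "\<dots> = s p * lower a' e * A_kernel e b'"
      using e y \<open>dec e\<close> by (subst Suc.IH) auto
    finally show ?thesis by (simp add: mult.assoc)
  next
    case False
    have "s p * A_kernel e b' = 0"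
    proof (cases "A_kernel e b' = 0 \<or> s p = 0")
      case nz: False
      then have "dec e" "\<forall>z\<in>set e. z < y"
        using A_kernel_nonzero_dec[of e b'] A_kernel_bound_iff[of e b' y] Suc.prems(4) by (auto simp: ab)
      moreover have "y \<le> p" using nz by (auto simp: s_def split: if_splits)
      ultimately have "dec (p # e)" by auto
      with False show ?thesis by simp
    qed auto
    then have "s p * (lower a' e * A_kernel e b') = 0" by (metis mult.left_commute mult_zero_right)
    moreover have "A_kernel (p # e) c = 0" for c using False A_kernel_nonzero_dec by blast
    ultimately show ?thesis by simp
  qed
  have "(\<Sum>e\<in>tuples n (Suc k). \<Sum>c\<in>tuples n (Suc k). lower a e * A_kernel e c * diff_weight c b) =
      (\<Sum>p\<in>{1..n}. s p * R)"
    unfolding R_def sum_distrib_left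
    by (subst sum_tuples_Suc) (intro sum.cong refl inner)
  also have "\<dots> = (\<Sum>p\<in>{1..n}. s p) * R"
    by (simp add: sum_distrib_right)
  also have "(\<Sum>p\<in>{1..n}. s p) = (\<Sum>p\<in>{y,Suc y}. s p)"
    by (rule sum.mono_neutral_cong) (use x y in \<open>auto simp: s_def\<close>)
  also have "\<dots> = of_bool (x = y)"
  proof (cases "Suc y \<le> x")
    case True
    then have "x - y = Suc (x - Suc y)" by simp
    with True show ?thesis by (simp add: s_def algebra_simps)
  qed (auto simp: s_def)
  also have "of_bool (x = y) * R = A_kernel a b"
    using Suc.prems(3) by (simp add: ab R_def len)
  finally show ?case .
qed

text \<open>The step of the determinant from one row to the next, on the left, becomes the step of the
  non-intersecting families, on the right.\<close>
lemma A_kernel_intertwines: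
  assumes "a \<in> tuples n k" "b \<in> tuples n k" "dec b"
  shows "(\<Sum>e\<in>tuples n k. A_kernel a e * (\<Sum>c\<in>tuples n k. of_bool (interlacing e c) * diff_weight c b)) =
    (\<Sum>d\<in>tuples n k. row_weight a d * A_kernel d b)"
proof -
  have "(\<Sum>e\<in>tuples n k. A_kernel a e * (\<Sum>c\<in>tuples n k. of_bool (interlacing e c) * diff_weight c b)) =
    (\<Sum>c\<in>tuples n k. (\<Sum>e\<in>tuples n k. A_kernel a e * of_bool (interlacing e c)) * diff_weight c b)"
    by (subst sum_distrib_left, subst sum.swap)
      (simp add: sum_distrib_right mult.assoc del: sum_mult_of_bool_eq sum_of_bool_mult_eq)
  also have "\<dots> = (\<Sum>c\<in>tuples n k. (\<Sum>d\<in>tuples n k. \<Sum>e\<in>tuples n k. row_weight a d * lower d e * A_kernel e c)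
      * diff_weight c b)"
    using assms(1) by (intro sum.cong refl arg_cong[where f = "\<lambda>s. s * _"] A_kernel_interlacing) auto
  also have "\<dots> = (\<Sum>d\<in>tuples n k. \<Sum>c\<in>tuples n k. \<Sum>e\<in>tuples n k.
      row_weight a d * (lower d e * A_kernel e c * diff_weight c b))"
    by (subst sum.swap) (simp add: sum_distrib_right mult.assoc)
  also have "\<dots> = (\<Sum>d\<in>tuples n k. row_weight a d *
      (\<Sum>e\<in>tuples n k. \<Sum>c\<in>tuples n k. lower d e * A_kernel e c * diff_weight c b))"
    by (subst (2) sum.swap) (simp add: sum_distrib_left)
  also have "\<dots> = (\<Sum>d\<in>tuples n k. row_weight a d * A_kernel d b)"
  proof (rule sum.cong[OF refl])
    fix d assume "d \<in> tuples n k"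
    then show "row_weight a d * (\<Sum>e\<in>tuples n k. \<Sum>c\<in>tuples n k. lower d e * A_kernel e c * diff_weight c b) =
      row_weight a d * A_kernel d b"
      using assms lower_A_kernel_diff_weight[of d k b] interlacing_dec_right[of a d] row_weight_zero[of a d]
      by (cases "interlacing a d") auto
  qed
  finally show ?thesis .
qed

end

section \<open>Determinants as functions of a tuple of columns\<close>

text \<open>The row functions \<open>f i\<close> are kept while the tuple of columns at which they are evaluated varies.\<close>
definition column_det :: "(nat \<Rightarrow> nat \<Rightarrow> 'a :: comm_ring_1) \<Rightarrow> nat list \<Rightarrow> 'a" where
  "column_det f c = det (mat (length c) (length c) (\<lambda>(i, j). f i (c ! j)))"

lemma prod_sum_tuples:
  fixes g :: "nat \<Rightarrow> nat \<Rightarrow> 'a :: comm_ring_1"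
  shows "(\<Prod>j<k. \<Sum>q\<in>{1..n}. g j q) = (\<Sum>c\<in>tuples n k. \<Prod>j<k. g j (c ! j))"
proof (induction k arbitrary: g)
  case 0
  then show ?case by (simp add: tuples_0)
next
  case (Suc k)
  show ?case
    unfolding prod.lessThan_Suc_shift sum_tuples_Suc Suc.IH sum_product by simp
qed

lemma column_det_multilinear:
  fixes f \<beta> :: "nat \<Rightarrow> nat \<Rightarrow> 'a :: comm_ring_1"
  shows "det (mat k k (\<lambda>(i, j). \<Sum>q\<in>{1..n}. \<beta> j q * f i q)) =
    (\<Sum>c\<in>tuples n k. (\<Prod>j<k. \<beta> j (c ! j)) * column_det f c)"
proof -
  have perm: "p j < k" if "p permutes {0..<k}" "j < k" for p :: "nat \<Rightarrow> nat" and j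
    using permutes_in_image[OF that(1), of j] that(2) by simp
  have "det (mat k k (\<lambda>(i, j). \<Sum>q\<in>{1..n}. \<beta> j q * f i q)) =
    (\<Sum>p | p permutes {0..<k}. signof p * (\<Prod>j<k. \<Sum>q\<in>{1..n}. \<beta> j q * f (p j) q))"
    using perm by (subst det_col[of _ k]) (auto intro!: sum.cong prod.cong)
  also have "\<dots> = (\<Sum>c\<in>tuples n k. \<Sum>p | p permutes {0..<k}.
      signof p * (\<Prod>j<k. \<beta> j (c ! j) * f (p j) (c ! j)))"
    unfolding prod_sum_tuples sum_distrib_left by (rule sum.swap)
  also have "\<dots> = (\<Sum>c\<in>tuples n k. (\<Prod>j<k. \<beta> j (c ! j)) * column_det f c)"
  proof (rule sum.cong[OF refl])
    fix c assume "c \<in> tuples n k"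
    then have "length c = k" by (simp add: tuples_def)
    then have "column_det f c = (\<Sum>p | p permutes {0..<k}. signof p * (\<Prod>j<k. f (p j) (c ! j)))"
      unfolding column_det_def using perm by (subst det_col[of _ k]) (auto intro!: sum.cong prod.cong)
    then show "(\<Sum>p | p permutes {0..<k}. signof p * (\<Prod>j<k. \<beta> j (c ! j) * f (p j) (c ! j))) =
        (\<Prod>j<k. \<beta> j (c ! j)) * column_det f c"
      by (simp add: prod.distrib sum_distrib_left mult_ac)
  qed
  finally show ?thesis .
qed

lemma column_det_not_distinct:
  assumes "\<not> distinct c"
  shows "column_det f c = 0"
proof -
  obtain i j where "i < length c" "j < length c" "i \<noteq> j" "c ! i = c ! j"
    using assms by (auto simp: distinct_conv_nth)
  then show ?thesis
    unfolding column_det_def by (intro det_identical_columns[of _ "length c" i j]) (auto intro!: eq_vecI)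
qed

lemma column_det_zero_column:
  assumes "x \<in> set c" "\<And>i. f i x = 0"
  shows "column_det f c = 0"
proof -
  obtain j where j: "j < length c" "c ! j = x" using assms(1) by (auto simp: in_set_conv_nth)
  have "(\<Prod>l<length c. f (p l) (c ! l)) = 0" for p
    using j assms(2) by (intro prod_zero) auto
  moreover have "p l < length c" if "p permutes {0..<length c}" "l < length c" for p l
    using permutes_in_image[OF that(1), of l] that(2) by simp
  ultimately show ?thesis
    unfolding column_det_def by (subst det_col[of _ "length c"]) (auto intro!: sum.neutral)
qed

lemma column_det_cong:
  assumes "\<And>i x. i < length c \<Longrightarrow> x \<in> set c \<Longrightarrow> f i x = g i x"
  shows "column_det f c = column_det g c"
  unfolding column_det_def by (rule arg_cong[where f = det], rule cong_mat) (use assms in auto)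

text \<open>Differences of neighbouring columns turn the sums over \<open>{d\<^sub>j..n}\<close> into sums over the disjoint blocks
  from \<open>d\<^sub>j\<close> to \<open>d\<^sub>j\<^sub>-\<^sub>1 - 1\<close>, and multilinearity then selects one element from each block. These
  selections are the tuples that interlace with \<open>d\<close>.\<close>
lemma column_det_suffix_sums:
  fixes f :: "nat \<Rightarrow> nat \<Rightarrow> 'a :: comm_ring_1"
  assumes "d \<in> tuples n k" "dec d"
  shows "column_det (\<lambda>i x. \<Sum>q\<in>{x..n}. f i q) d = (\<Sum>c\<in>tuples n k. of_bool (interlacing c d) * column_det f c)"
proof -
  have len: "length d = k" and pos: "\<And>j. j < k \<Longrightarrow> 1 \<le> d ! j"
    using length_tuples[OF assms(1)] nth_tuples[OF assms(1)] by auto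
  define \<beta> :: "nat \<Rightarrow> nat \<Rightarrow> 'a" where
    "\<beta> j q = of_bool (d ! j \<le> q \<and> (0 < j \<longrightarrow> q < d ! (j - 1)))" for j q
  \<comment> \<open>\<open>G\<close> contains the block sums, and multiplication by \<open>U\<close> adds them up again.\<close>
  define G where "G = mat k k (\<lambda>(i, j). \<Sum>q\<in>{1..n}. \<beta> j q * f i q)"
  define U :: "'a mat" where "U = mat k k (\<lambda>(l, j). of_bool (l \<le> j))"
  have part: "(\<Sum>l\<le>j. \<beta> l q) = of_bool (d ! j \<le> q)" if "j < k" for j q
    using that
  proof (induction j)
    case 0
    then show ?case by (simp add: \<beta>_def)
  next
    case (Suc j)
    have "d ! Suc j < d ! j" using assms(2) Suc.prems len by (auto simp: sorted_wrt_iff_nth_less)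
    then show ?case using Suc by (auto simp: \<beta>_def)
  qed
  have "mat k k (\<lambda>(i, j). \<Sum>q\<in>{d ! j..n}. f i q) = G * U"
  proof (rule eq_matI)
    fix i j assume "i < dim_row (G * U)" "j < dim_col (G * U)"
    then have ij: "i < k" "j < k" by (auto simp: G_def U_def)
    have "(G * U) $$ (i, j) = (\<Sum>l<k. (\<Sum>q\<in>{1..n}. \<beta> l q * f i q) * of_bool (l \<le> j))"
      using ij by (simp add: G_def U_def scalar_prod_def lessThan_atLeast0
          del: sum_mult_of_bool_eq sum_of_bool_mult_eq)
    also have "\<dots> = (\<Sum>l\<le>j. \<Sum>q\<in>{1..n}. \<beta> l q * f i q)"
      by (rule sum.mono_neutral_cong_right) (use ij in auto)
    also have "\<dots> = (\<Sum>q\<in>{1..n}. (\<Sum>l\<le>j. \<beta> l q) * f i q)"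
      by (subst sum.swap) (simp add: sum_distrib_right)
    also have "\<dots> = (\<Sum>q\<in>{1..n}. of_bool (d ! j \<le> q) * f i q)"
      using part[OF ij(2)] by simp
    also have "\<dots> = (\<Sum>q\<in>{d ! j..n}. f i q)"
      by (rule sum.mono_neutral_cong_right) (use pos[OF ij(2)] in auto)
    finally show "mat k k (\<lambda>(i, j). \<Sum>q\<in>{d ! j..n}. f i q) $$ (i, j) = (G * U) $$ (i, j)"
      using ij by simp
  qed (auto simp: G_def U_def)
  moreover have "det U = 1"
  proof -
    have "det U = prod_list (diag_mat U)"
      by (rule det_upper_triangular[of _ k]) (auto simp: U_def)
    also have "diag_mat U = replicate k 1"
      by (auto simp: diag_mat_def U_def intro: nth_equalityI)
    finally show ?thesis by simp
  qed
  ultimately have "column_det (\<lambda>i x. \<Sum>q\<in>{x..n}. f i q) d = det G"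
    unfolding column_det_def len by (simp add: det_mult[of _ k] G_def U_def)
  also have "\<dots> = (\<Sum>c\<in>tuples n k. (\<Prod>j<k. \<beta> j (c ! j)) * column_det f c)"
    unfolding G_def by (rule column_det_multilinear)
  also have "\<dots> = (\<Sum>c\<in>tuples n k. of_bool (interlacing c d) * column_det f c)"
  proof (intro sum.cong refl arg_cong[where f = "\<lambda>s. s * _"])
    fix c assume "c \<in> tuples n k"
    then have lc: "length c = k" by (simp add: tuples_def)
    have "interlacing c d \<longleftrightarrow> (\<forall>j<k. d ! j \<le> c ! j \<and> (0 < j \<longrightarrow> c ! j < d ! (j - 1)))" (is "_ \<longleftrightarrow> ?r")
    proof
      assume "interlacing c d"
      then show ?r by (auto simp: interlacing_iff_nth len)
    next
      assume r: ?r
      have "c ! j < d ! i" if "i < j" "j < k" for i j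
      proof -
        have "d ! (j - 1) \<le> d ! i"
          using assms(2) that len by (cases "i = j - 1") (auto simp: sorted_wrt_iff_nth_less intro: less_imp_le)
        moreover have "c ! j < d ! (j - 1)" using r that by auto
        ultimately show ?thesis by (rule less_le_trans[rotated])
      qed
      with r show "interlacing c d" by (auto simp: interlacing_iff_nth len lc)
    qed
    moreover have "(\<Prod>j<k. \<beta> j (c ! j)) = of_bool (\<forall>j<k. d ! j \<le> c ! j \<and> (0 < j \<longrightarrow> c ! j < d ! (j - 1)))"
    proof (cases "\<forall>j<k. d ! j \<le> c ! j \<and> (0 < j \<longrightarrow> c ! j < d ! (j - 1))")
      case True
      then show ?thesis by (simp add: \<beta>_def)
    next
      case False
      then obtain j where "j < k" "\<beta> j (c ! j) = 0" by (auto simp: \<beta>_def)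
      then have "(\<Prod>j<k. \<beta> j (c ! j)) = 0" by (meson finite_lessThan lessThan_iff prod_zero)
      with False show ?thesis by (simp del: not_all)
    qed
    ultimately show "(\<Prod>j<k. \<beta> j (c ! j)) = of_bool (interlacing c d)" by simp
  qed
  finally show ?thesis .
qed

lemma diff_weight_prod:
  "length c = length d \<Longrightarrow>
   (\<Prod>j<length d. if c ! j = d ! j then 1 else if c ! j = Suc (d ! j) then - (1 - t) else 0) =
   diff_weight t c d"
proof (induction c d rule: list_induct2)
  case (Cons x c y d)
  have "(\<Prod>j<length (y # d). if (x # c) ! j = (y # d) ! j then 1
      else if (x # c) ! j = Suc ((y # d) ! j) then - (1 - t) else 0) =
    (if x = y then 1 else if x = Suc y then - (1 - t) else 0) *
    (\<Prod>j<length d. if c ! j = d ! j then 1 else if c ! j = Suc (d ! j) then - (1 - t) else 0)"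
    unfolding list.size(4) add_0_right add_Suc_right prod.lessThan_Suc_shift nth_Cons_0 nth_Cons_Suc
    by simp
  with Cons.IH show ?case by simp
qed simp

text \<open>The assumption on \<open>f\<close> at \<open>n + 1\<close> lets the entries of the new tuples stay in \<open>{1..n}\<close>.\<close>
lemma column_det_differences:
  fixes f :: "nat \<Rightarrow> nat \<Rightarrow> 'a :: comm_ring_1"
  assumes "d \<in> tuples n k" and zero: "\<And>i. f i (Suc n) = 0"
  shows "column_det (\<lambda>i x. f i x - (1 - t) * f i (Suc x)) d = (\<Sum>c\<in>tuples n k. diff_weight t c d * column_det f c)"
proof -
  have len: "length d = k" using assms(1) by (simp add: tuples_def)
  define \<beta> where "\<beta> j q = (if q = d ! j then 1 else if q = Suc (d ! j) then - (1 - t) else 0)" for j q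
  have "column_det (\<lambda>i x. f i x - (1 - t) * f i (Suc x)) d = det (mat k k (\<lambda>(i, j). \<Sum>q\<in>{1..n}. \<beta> j q * f i q))"
    unfolding column_det_def len
  proof (rule arg_cong[where f = det], rule cong_mat, goal_cases)
    case (3 i j)
    have dj: "d ! j \<in> {1..n}" using nth_tuples[OF assms(1)] 3 by simp
    have "(\<Sum>q\<in>{1..n}. \<beta> j q * f i q) = (\<Sum>q\<in>{1..Suc n}. \<beta> j q * f i q)"
      by (simp add: zero)
    also have "\<dots> = (\<Sum>q\<in>{d ! j, Suc (d ! j)}. \<beta> j q * f i q)"
      by (rule sum.mono_neutral_right) (use dj in \<open>auto simp: \<beta>_def\<close>)
    finally show ?case by (simp add: \<beta>_def algebra_simps)
  qed auto
  also have "\<dots> = (\<Sum>c\<in>tuples n k. (\<Prod>j<k. \<beta> j (c ! j)) * column_det f c)"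
    by (rule column_det_multilinear)
  also have "\<dots> = (\<Sum>c\<in>tuples n k. diff_weight t c d * column_det f c)"
  proof (intro sum.cong refl arg_cong[where f = "\<lambda>s. s * _"])
    fix c assume "c \<in> tuples n k"
    then show "(\<Prod>j<k. \<beta> j (c ! j)) = diff_weight t c d"
      unfolding \<beta>_def using diff_weight_prod[of c d t] by (simp add: tuples_def len)
  qed
  finally show ?thesis .
qed

text \<open>The entries of \<open>c\<close> are those of \<open>d\<close>, some of them increased by one; this keeps them weakly
  decreasing. Tuples with a repetition contribute a vanishing determinant.\<close>
lemma diff_weight_dec_or_repeated:
  assumes "diff_weight t c d \<noteq> 0" "dec d"
  shows "dec c \<or> \<not> distinct c"
proof -
  have bound: "z \<le> Suc y" if "diff_weight t c d \<noteq> 0" "z \<in> set c" "\<And>v. v \<in> set d \<Longrightarrow> v \<le> y" for c d z y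
    using that
  proof (induction c d rule: interlacing.induct)
    case (2 p c q d)
    then have "diff_weight t c d \<noteq> 0" "p \<le> Suc q" by (auto split: if_splits)
    moreover have "q \<le> y" by (rule 2(4)) simp
    moreover have "z \<le> Suc y" if "z \<in> set c" using 2 that \<open>diff_weight t c d \<noteq> 0\<close> by simp
    ultimately show ?case using 2(3) by auto
  qed auto
  have "sorted_wrt (\<ge>) c"
    using assms
  proof (induction c d rule: interlacing.induct)
    case (2 x c y d)
    have nz: "diff_weight t c d \<noteq> 0" and "y \<le> x" using 2 by (auto split: if_splits)
    moreover have "z \<le> y" if "z \<in> set c" for z
    proof (cases d)
      case Nil
      with nz that show ?thesis by (cases c) auto
    next
      case (Cons v d')
      have "z \<le> Suc (y - 1)" using bound[OF nz that, of "y - 1"] 2 by fastforce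
      moreover have "0 < y" using 2 Cons by auto
      ultimately show ?thesis by simp
    qed
    ultimately show ?case using 2 by force
  qed auto
  then show ?thesis by (induction c) (auto simp: less_le)
qed

text \<open>The transfer matrix with entries \<open>1\<close> on the diagonal and \<open>t\<close> beyond it takes \<open>g\<close> to
  \<open>f x - (1 - t) f (x + 1)\<close> with \<open>f\<close> the suffix sums of \<open>g\<close>, so its minors factor accordingly.\<close>
lemma column_det_row_transfer:
  fixes g :: "nat \<Rightarrow> nat \<Rightarrow> 'a :: comm_ring_1"
  assumes d: "d \<in> tuples n k" "dec d"
  shows "column_det (\<lambda>i x. \<Sum>p\<in>{x..n}. (if p = x then 1 else t) * g i p) d =
    (\<Sum>e\<in>tuples n k. column_det g e * (\<Sum>c\<in>tuples n k. of_bool (interlacing e c) * diff_weight t c d))"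
proof -
  let ?f = "\<lambda>i x. \<Sum>p\<in>{x..n}. g i p"
  have "column_det (\<lambda>i x. \<Sum>p\<in>{x..n}. (if p = x then 1 else t) * g i p) d =
    column_det (\<lambda>i x. ?f i x - (1 - t) * ?f i (Suc x)) d"
  proof (rule column_det_cong)
    fix i x assume "x \<in> set d"
    then have "{x..n} = insert x {Suc x..n}" using d(1) by (auto simp: tuples_def)
    then show "(\<Sum>p\<in>{x..n}. (if p = x then 1 else t) * g i p) = ?f i x - (1 - t) * ?f i (Suc x)"
      by (simp add: sum_distrib_left[symmetric] algebra_simps)
  qed
  also have "\<dots> = (\<Sum>c\<in>tuples n k. diff_weight t c d * column_det ?f c)"
    using d(1) by (rule column_det_differences) simp
  also have "\<dots> = (\<Sum>c\<in>tuples n k. \<Sum>e\<in>tuples n k. column_det g e * (of_bool (interlacing e c) * diff_weight t c d))"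
  proof (rule sum.cong[OF refl])
    fix c assume c: "c \<in> tuples n k"
    consider "diff_weight t c d = 0" | "dec c" | "\<not> dec c" "\<not> distinct c"
      using diff_weight_dec_or_repeated d(2) by blast
    then show "diff_weight t c d * column_det ?f c =
        (\<Sum>e\<in>tuples n k. column_det g e * (of_bool (interlacing e c) * diff_weight t c d))"
    proof cases
      case 2
      show ?thesis unfolding column_det_suffix_sums[OF c 2] sum_distrib_left
        by (simp only: mult_ac)
    next
      case 3
      then have "\<not> interlacing e c" for e using interlacing_dec_right by blast
      then show ?thesis by (simp add: column_det_not_distinct[OF 3(2)])
    qed simp
  qed
  also have "\<dots> = (\<Sum>e\<in>tuples n k. column_det g e * (\<Sum>c\<in>tuples n k. of_bool (interlacing e c) * diff_weight t c d))"
    unfolding sum_distrib_left by (rule sum.swap)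
  finally show ?thesis .
qed

lemma column_det_lower_triangular:
  fixes cf :: "nat \<Rightarrow> nat \<Rightarrow> 'a :: comm_ring_1"
  assumes "\<And>i q. i < q \<Longrightarrow> cf i q = 0"
  shows "column_det (\<lambda>i x. \<Sum>q<length c. cf i q * f q x) c = (\<Prod>i<length c. cf i i) * column_det f c"
proof -
  let ?k = "length c"
  have "mat ?k ?k (\<lambda>(i, j). \<Sum>q<?k. cf i q * f q (c ! j)) =
    mat ?k ?k (\<lambda>(i, q). cf i q) * mat ?k ?k (\<lambda>(q, j). f q (c ! j))"
    by (rule eq_matI) (auto simp: scalar_prod_def lessThan_atLeast0)
  moreover have "det (mat ?k ?k (\<lambda>(i, q). cf i q)) = (\<Prod>i<?k. cf i i)"
    using assms by (subst det_lower_triangular[of ?k]) (auto simp: prod_list_diag_prod lessThan_atLeast0)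
  ultimately show ?thesis by (simp add: column_det_def det_mult[of _ ?k])
qed

lemma column_det_Cons_corner:
  assumes "\<And>x. x \<in> set c \<Longrightarrow> f 0 x = 0"
  shows "column_det f (q # c) = f 0 q * column_det (\<lambda>i. f (Suc i)) c"
proof -
  let ?k = "Suc (length c)"
  let ?A = "mat ?k ?k (\<lambda>(i, j). f i ((q # c) ! j))"
  have "column_det f (q # c) = (\<Sum>j<?k. ?A $$ (0, j) * cofactor ?A 0 j)"
    unfolding column_det_def by (subst laplace_expansion_row[of _ ?k 0]) auto
  also have "\<dots> = (\<Sum>j\<in>{0}. ?A $$ (0, j) * cofactor ?A 0 j)"
    by (rule sum.mono_neutral_right) (use assms in \<open>auto simp: nth_Cons split: nat.splits\<close>)
  also have "\<dots> = f 0 q * det (mat_delete ?A 0 0)"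
    by (simp add: cofactor_def)
  also have "mat_delete ?A 0 0 = mat (length c) (length c) (\<lambda>(i, j). f (Suc i) (c ! j))"
    by (rule eq_matI) (auto simp: mat_delete_def)
  finally show ?thesis by (simp add: column_det_def)
qed

text \<open>For \<open>s \<ge> 1\<close> and \<open>x \<le> n\<close> this is the binomial coefficient \<open>n - x + s - 1\<close> over \<open>s - 1\<close>.\<close>
fun iterated_sum :: "nat \<Rightarrow> nat \<Rightarrow> nat \<Rightarrow> 'a :: comm_ring_1" where
  "iterated_sum n 0 x = of_bool (x = n)"
| "iterated_sum n (Suc s) x = (\<Sum>q\<in>{x..n}. iterated_sum n s q)"

text \<open>After one suffix summation is taken out, the first row is the indicator of column \<open>n\<close>. Hence the
  largest entry of an interlacing tuple has to be \<open>n\<close>, and deleting it leaves a determinant of the original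
  form. So the determinant counts the triangular arrays with bottom row \<open>y # d\<close> in which
  neighbouring rows interlace.\<close>
lemma column_det_iterated_sum_Cons:
  assumes "y # d \<in> tuples n (Suc k)" "dec (y # d)"
  shows "column_det (\<lambda>i. iterated_sum n (Suc i)) (y # d) =
    (\<Sum>c\<in>tuples n k. of_bool (interlacing c d \<and> (\<forall>z\<in>set c. z < y)) *
       column_det (\<lambda>i. iterated_sum n (Suc i)) c :: 'a :: comm_ring_1)"
proof -
  have y: "y \<in> {1..n}" using assms(1) by (simp add: tuples_def)
  have "column_det (\<lambda>i. iterated_sum n (Suc i)) (y # d) =
    (\<Sum>p\<in>{1..n}. \<Sum>c\<in>tuples n k. of_bool (interlacing (p # c) (y # d)) * column_det (iterated_sum n) (p # c) :: 'a)"
    unfolding iterated_sum.simps column_det_suffix_sums[OF assms] by (rule sum_tuples_Suc)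
  also have "\<dots> = (\<Sum>p\<in>{1..n}. if p = n then \<Sum>c\<in>tuples n k.
      of_bool (interlacing c d \<and> (\<forall>z\<in>set c. z < y)) * column_det (\<lambda>i. iterated_sum n (Suc i)) c else 0)"
  proof (rule sum.cong[OF refl])
    fix p assume p: "p \<in> {1..n}"
    have "of_bool (interlacing (p # c) (y # d)) * column_det (iterated_sum n) (p # c) = of_bool (p = n) *
        (of_bool (interlacing c d \<and> (\<forall>z\<in>set c. z < y)) * column_det (\<lambda>i. iterated_sum n (Suc i)) c :: 'a)" for c
    proof (cases "interlacing c d \<and> (\<forall>z\<in>set c. z < y)")
      case True
      then have "iterated_sum n 0 z = (0 :: 'a)" if "z \<in> set c" for z using that y by auto
      with True y show ?thesis by (subst column_det_Cons_corner) auto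
    qed auto
    then show "(\<Sum>c\<in>tuples n k. of_bool (interlacing (p # c) (y # d)) * column_det (iterated_sum n) (p # c) :: 'a) =
      (if p = n then \<Sum>c\<in>tuples n k. of_bool (interlacing c d \<and> (\<forall>z\<in>set c. z < y)) *
         column_det (\<lambda>i. iterated_sum n (Suc i)) c else 0)"
      by simp
  qed
  also have "\<dots> = (\<Sum>c\<in>tuples n k. of_bool (interlacing c d \<and> (\<forall>z\<in>set c. z < y)) *
      column_det (\<lambda>i. iterated_sum n (Suc i)) c)"
    using y by simp
  finally show ?thesis .
qed

section \<open>Lattice paths, one row at a time\<close>

lemma chain_between_iff:
  "chain_between Y P Q C \<longleftrightarrow> C \<subseteq> Y \<and> P \<in> C \<and> Q \<in> C \<and>
     (\<forall>x\<in>C. point_le Q x \<and> point_le x P) \<and> (\<forall>x\<in>C. \<forall>y\<in>C. point_le x y \<or> point_le y x)"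
proof -
  have "point_le x x" for x by (simp add: point_le_def)
  then show ?thesis by (auto simp: chain_between_def pred_on.chain_def) metis
qed

text \<open>The form in which the maximality of a path is used.\<close>
lemma path_saturated:
  assumes "is_path Y P Q C" "x \<in> Y" "point_le Q x" "point_le x P"
    and "\<And>y. y \<in> C \<Longrightarrow> point_le x y \<or> point_le y x"
  shows "x \<in> C"
proof (rule ccontr)
  assume "x \<notin> C"
  have "point_le x x" by (simp add: point_le_def)
  then have "chain_between Y P Q (insert x C)"
    using assms unfolding is_path_def chain_between_iff by blast
  with assms(1) \<open>x \<notin> C\<close> show False unfolding is_path_def by blast
qed

lemma path_start: "is_path Y P Q C \<Longrightarrow> P \<in> C"
  and path_end: "is_path Y P Q C \<Longrightarrow> Q \<in> C"
  and path_subset: "is_path Y P Q C \<Longrightarrow> C \<subseteq> Y"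
  and path_bounds: "is_path Y P Q C \<Longrightarrow> x \<in> C \<Longrightarrow> point_le Q x \<and> point_le x P"
  and path_linear: "is_path Y P Q C \<Longrightarrow> x \<in> C \<Longrightarrow> y \<in> C \<Longrightarrow> point_le x y \<or> point_le y x"
  by (auto simp: is_path_def chain_between_iff)

lemma path_rows_le: "is_path Y P (m, j) C \<Longrightarrow> p \<in> C \<Longrightarrow> fst p \<le> m"
  and path_cols_ge: "is_path Y P (m, j) C \<Longrightarrow> p \<in> C \<Longrightarrow> j \<le> snd p"
  using path_bounds by (fastforce simp: point_le_def)+

lemma corners_row: "corners ({Suc a} \<times> B) = {}"
  by (auto simp: corners_def)

context
  fixes M n :: nat and Y :: "point set"
  assumes ladder: "one_sided_ladder M n Y"
begin

lemma ladder_bounds: "(i, j) \<in> Y \<Longrightarrow> 1 \<le> i \<and> i \<le> M \<and> 1 \<le> j \<and> j \<le> n"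
  using ladder by (auto simp: one_sided_ladder_def rect_def)

lemma ladder_down: "(i, j) \<in> Y \<Longrightarrow> 1 \<le> i' \<Longrightarrow> i' \<le> i \<Longrightarrow> 1 \<le> j' \<Longrightarrow> j' \<le> j \<Longrightarrow> (i', j') \<in> Y"
  using ladder by (auto simp: one_sided_ladder_def)

lemma finite_ladder: "finite Y"
  using ladder finite_subset[of Y "rect M n"] by (auto simp: one_sided_ladder_def rect_def)

lemma path_in_row_iff:
  "is_path Y (a, n) (a, b) C \<longleftrightarrow> (a, n) \<in> Y \<and> 1 \<le> b \<and> b \<le> n \<and> C = {a} \<times> {b..n}"
proof
  assume C: "is_path Y (a, n) (a, b) C"
  have Y: "(a, n) \<in> Y" "(a, b) \<in> Y" using path_start[OF C] path_end[OF C] path_subset[OF C] by auto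
  then have b: "1 \<le> b" "b \<le> n" using ladder_bounds by auto
  have sub: "C \<subseteq> {a} \<times> {b..n}" using path_bounds[OF C] by (force simp: point_le_def)
  have "{a} \<times> {b..n} \<subseteq> C"
  proof
    fix p assume "p \<in> {a} \<times> {b..n}"
    then show "p \<in> C"
      using Y b ladder_bounds[OF Y(1)] sub
      by (intro path_saturated[OF C]) (auto simp: point_le_def intro: ladder_down)
  qed
  with sub b Y show "(a, n) \<in> Y \<and> 1 \<le> b \<and> b \<le> n \<and> C = {a} \<times> {b..n}" by auto
next
  assume r: "(a, n) \<in> Y \<and> 1 \<le> b \<and> b \<le> n \<and> C = {a} \<times> {b..n}"
  have "C \<subseteq> Y" using r ladder_bounds[of a n] by (auto intro: ladder_down)
  moreover have "D \<subseteq> {a} \<times> {b..n}" if "chain_between Y (a, n) (a, b) D" for D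
    using that by (force simp: chain_between_iff point_le_def)
  moreover have "chain_between Y (a, n) (a, b) C"
    unfolding chain_between_iff using r \<open>C \<subseteq> Y\<close> by (auto simp: point_le_def)
  ultimately show "is_path Y (a, n) (a, b) C"
    using r unfolding is_path_def by blast
qed

text \<open>The column \<open>j\<close> is the one in which the path enters the last row. All other rows of the path lie in
  columns from \<open>j\<close> on, because their points are comparable with \<open>(Suc m, j)\<close>; so \<open>(m, j)\<close> and the segment from
  \<open>j\<close> to \<open>b\<close> are comparable with the whole path and belong to it by maximality.\<close>
lemma path_next_row_iff:
  assumes am: "a \<le> m"
  shows "is_path Y (a, n) (Suc m, b) C \<longleftrightarrow>
    (\<exists>j C'. 1 \<le> b \<and> b \<le> j \<and> (Suc m, j) \<in> Y \<and> is_path Y (a, n) (m, j) C' \<and> C = C' \<union> {Suc m} \<times> {b..j})"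
    (is "_ \<longleftrightarrow> (\<exists>j C'. ?R j C')")
proof
  assume C: "is_path Y (a, n) (Suc m, b) C"
  have Y: "(a, n) \<in> Y" "(Suc m, b) \<in> Y" using path_start[OF C] path_end[OF C] path_subset[OF C] by auto
  have pos: "1 \<le> a" "1 \<le> b" using ladder_bounds Y by auto
  define j where "j = Max {x. (Suc m, x) \<in> C}"
  have fin: "finite {x. (Suc m, x) \<in> C}"
    by (rule finite_subset[of _ "{..n}"]) (use path_subset[OF C] ladder_bounds in auto)
  have "j \<in> {x. (Suc m, x) \<in> C}"
    unfolding j_def using fin path_end[OF C] by (intro Max_in) auto
  then have jC: "(Suc m, j) \<in> C" by simp
  have j_max: "x \<le> j" if "(Suc m, x) \<in> C" for x
    unfolding j_def using fin that by (intro Max_ge) auto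
  have jY: "(Suc m, j) \<in> Y" using jC path_subset[OF C] by auto
  have bj: "b \<le> j" using path_end[OF C] j_max by auto
  have jn: "j \<le> n" using ladder_bounds[OF jY] by simp
  have cases_C: "(i \<le> m \<and> j \<le> x) \<or> (i = Suc m \<and> b \<le> x \<and> x \<le> j)" "i \<ge> a" "x \<le> n" if "(i, x) \<in> C" for i x
    using path_bounds[OF C that] path_linear[OF C that jC] j_max[of x] that
    by (auto simp: point_le_def not_less_eq_eq le_Suc_eq)
  have seg: "{Suc m} \<times> {b..j} \<subseteq> C"
  proof
    fix p assume p: "p \<in> {Suc m} \<times> {b..j}"
    then have "p \<in> Y" using jY pos by (auto intro: ladder_down)
    moreover have "point_le p q \<or> point_le q p" if "q \<in> C" for q
      using cases_C[of "fst q" "snd q"] that p by (auto simp: point_le_def)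
    ultimately show "p \<in> C" using p am jn by (intro path_saturated[OF C]) (auto simp: point_le_def)
  qed
  have mY: "(m, j) \<in> Y" using jY pos am bj by (auto intro: ladder_down)
  have mC: "(m, j) \<in> C"
  proof (rule path_saturated[OF C mY])
    fix q assume "q \<in> C"
    then show "point_le (m, j) q \<or> point_le q (m, j)"
      using cases_C[of "fst q" "snd q"] by (auto simp: point_le_def)
  qed (use am bj jn in \<open>auto simp: point_le_def\<close>)
  define C' where "C' = {p \<in> C. fst p \<le> m}"
  have C_eq: "C = C' \<union> {Suc m} \<times> {b..j}"
    using seg cases_C by (force simp: C'_def)
  have "is_path Y (a, n) (m, j) C'"
    unfolding is_path_def
  proof
    show "chain_between Y (a, n) (m, j) C'"
      unfolding chain_between_iff
    proof (intro conjI ballI)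
      show "C' \<subseteq> Y" "(a, n) \<in> C'" "(m, j) \<in> C'"
        using path_subset[OF C] path_start[OF C] mC am by (auto simp: C'_def)
    next
      fix x assume "x \<in> C'"
      then show "point_le (m, j) x" "point_le x (a, n)"
        using cases_C[of "fst x" "snd x"] by (auto simp: C'_def point_le_def)
    next
      fix x y assume "x \<in> C'" "y \<in> C'"
      then show "point_le x y \<or> point_le y x" using path_linear[OF C] by (auto simp: C'_def)
    qed
    show "\<nexists>D. chain_between Y (a, n) (m, j) D \<and> C' \<subset> D"
    proof
      assume "\<exists>D. chain_between Y (a, n) (m, j) D \<and> C' \<subset> D"
      then obtain D where D: "chain_between Y (a, n) (m, j) D" "C' \<subset> D" by blast
      have D_bounds: "fst x \<le> m \<and> a \<le> fst x \<and> j \<le> snd x \<and> snd x \<le> n" if "x \<in> D" for x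
        using D(1) that by (auto simp: chain_between_iff point_le_def)
      have "chain_between Y (a, n) (Suc m, b) (D \<union> {Suc m} \<times> {b..j})"
        unfolding chain_between_iff
      proof (intro conjI ballI)
        show "D \<union> {Suc m} \<times> {b..j} \<subseteq> Y" "(a, n) \<in> D \<union> {Suc m} \<times> {b..j}"
          using D(1) seg path_subset[OF C] by (auto simp: chain_between_iff)
        show "(Suc m, b) \<in> D \<union> {Suc m} \<times> {b..j}" using bj by simp
      next
        fix x assume "x \<in> D \<union> {Suc m} \<times> {b..j}"
        then show "point_le (Suc m, b) x" "point_le x (a, n)"
          using D_bounds[of x] bj jn am by (auto simp: point_le_def)
      next
        fix x y assume "x \<in> D \<union> {Suc m} \<times> {b..j}" "y \<in> D \<union> {Suc m} \<times> {b..j}"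
        moreover have "point_le x y \<or> point_le y x" if "x \<in> D" "y \<in> D"
          using D(1) that unfolding chain_between_iff by blast
        ultimately show "point_le x y \<or> point_le y x"
          using D_bounds[of x] D_bounds[of y] by (auto simp: point_le_def)
      qed
      moreover have "C \<subset> D \<union> {Suc m} \<times> {b..j}"
      proof -
        obtain p where "p \<in> D" "p \<notin> C'" using D(2) by blast
        with D_bounds[of p] have "p \<notin> C" by (auto simp: C'_def)
        with \<open>p \<in> D\<close> D(2) show ?thesis unfolding C_eq by blast
      qed
      ultimately show False using C unfolding is_path_def by blast
    qed
  qed
  with C_eq pos bj jY have "?R j C'" by simp
  then show "\<exists>j C'. ?R j C'" by blast
next
  assume "\<exists>j C'. ?R j C'"
  then obtain j C' where b: "1 \<le> b" "b \<le> j" and jY: "(Suc m, j) \<in> Y" and C': "is_path Y (a, n) (m, j) C'"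
    and C_eq: "C = C' \<union> {Suc m} \<times> {b..j}" by blast
  have jn: "j \<le> n" using ladder_bounds[OF jY] by simp
  have C'_bounds: "fst x \<le> m \<and> a \<le> fst x \<and> j \<le> snd x \<and> snd x \<le> n" if "x \<in> C'" for x
    using path_bounds[OF C' that] by (auto simp: point_le_def)
  show "is_path Y (a, n) (Suc m, b) C"
    unfolding is_path_def
  proof
    show "chain_between Y (a, n) (Suc m, b) C"
      unfolding chain_between_iff
    proof (intro conjI ballI)
      show "C \<subseteq> Y" using path_subset[OF C'] jY b by (auto simp: C_eq intro: ladder_down)
      show "(a, n) \<in> C" "(Suc m, b) \<in> C" using path_start[OF C'] b by (auto simp: C_eq)
    next
      fix x assume "x \<in> C"
      then show "point_le (Suc m, b) x" "point_le x (a, n)"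
        using C'_bounds[of x] b jn am by (auto simp: point_le_def C_eq)
    next
      fix x y assume "x \<in> C" "y \<in> C"
      then show "point_le x y \<or> point_le y x"
        using C'_bounds[of x] C'_bounds[of y] path_linear[OF C', of x y] by (auto simp: point_le_def C_eq)
    qed
    show "\<nexists>D. chain_between Y (a, n) (Suc m, b) D \<and> C \<subset> D"
    proof
      assume "\<exists>D. chain_between Y (a, n) (Suc m, b) D \<and> C \<subset> D"
      then obtain D where D: "chain_between Y (a, n) (Suc m, b) D" "C \<subset> D" by blast
      have lin: "point_le x y \<or> point_le y x" if "x \<in> D" "y \<in> D" for x y
        using D(1) that unfolding chain_between_iff by blast
      have bnd: "fst x \<le> Suc m \<and> b \<le> snd x \<and> point_le x (a, n)" if "x \<in> D" for x
        using D(1) that by (auto simp: chain_between_iff point_le_def)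
      have mem: "(m, j) \<in> D" "(Suc m, j) \<in> D"
        using psubset_imp_subset[OF D(2)] path_end[OF C'] b by (auto simp: C_eq)
      define D' where "D' = {p \<in> D. fst p \<le> m}"
      have "chain_between Y (a, n) (m, j) D'"
        unfolding chain_between_iff
      proof (intro conjI ballI)
        show "D' \<subseteq> Y" "(a, n) \<in> D'" "(m, j) \<in> D'"
          using D(1) mem am by (auto simp: chain_between_iff D'_def)
      next
        fix x assume x: "x \<in> D'"
        then show "point_le x (a, n)" using bnd by (auto simp: D'_def)
        show "point_le (m, j) x"
          using x lin[of x "(Suc m, j)"] mem by (auto simp: D'_def point_le_def)
      next
        fix x y assume "x \<in> D'" "y \<in> D'"
        then show "point_le x y \<or> point_le y x" using lin by (auto simp: D'_def)
      qed
      moreover have "C' \<subseteq> D'" using D(2) C'_bounds by (auto simp: D'_def C_eq)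
      ultimately have D'_eq: "D' = C'" using C' unfolding is_path_def by blast
      have "D \<subseteq> C"
      proof
        fix p assume p: "p \<in> D"
        show "p \<in> C"
        proof (cases "fst p \<le> m")
          case True
          with p D'_eq show ?thesis by (auto simp: D'_def C_eq)
        next
          case False
          with bnd[OF p] have "fst p = Suc m" by simp
          with lin[OF p mem(1)] bnd[OF p] show ?thesis
            by (cases p) (auto simp: point_le_def C_eq)
        qed
      qed
      with D(2) show False by blast
    qed
  qed
qed

text \<open>The only new corner can be the point \<open>(Suc m, j)\<close> in which the path enters the row.\<close>
lemma card_corners_next_row:
  assumes C': "is_path Y (a, n) (m, j) C'" and b: "1 \<le> b" "b \<le> j"
  shows "card (corners (C' \<union> {Suc m} \<times> {b..j})) = card (corners C') + of_bool (b < j)"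
proof -
  have rows: "fst p \<le> m" "j \<le> snd p" "1 \<le> snd p" if "p \<in> C'" for p
    using path_rows_le[OF C' that] path_cols_ge[OF C' that] path_subset[OF C'] that
      ladder_bounds[of "fst p" "snd p"] by auto
  have "(m, j) \<in> C'" by (rule path_end[OF C'])
  then have "corners (C' \<union> {Suc m} \<times> {b..j}) = corners C' \<union> (if b < j then {(Suc m, j)} else {})"
    using rows b by (force simp: corners_def)
  moreover have "finite (corners C')"
    using finite_subset[OF path_subset[OF C'] finite_ladder] by (auto simp: corners_def intro: finite_subset)
  moreover have "(Suc m, j) \<notin> corners C'" using rows by (force simp: corners_def)
  ultimately show ?thesis by auto
qed

end

section \<open>Non-intersecting families, one row at a time\<close>

definition indet :: "int poly" where
  "indet = monom 1 1"

lemma row_weight_eq_power: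
  "interlacing a b \<Longrightarrow> row_weight t a b = t ^ (\<Sum>i<length b. of_bool (b ! i < a ! i))"
proof (induction a b rule: interlacing.induct)
  case (2 x a y b)
  have "(\<Sum>i<length (y # b). of_bool ((y # b) ! i < (x # a) ! i)) =
      of_bool (y < x) + (\<Sum>i<length b. of_bool (b ! i < a ! i) :: nat)"
    unfolding list.size(4) add_0_right add_Suc_right sum.lessThan_Suc_shift nth_Cons_0 nth_Cons_Suc
    by (simp only: add.commute)
  with 2 show ?case by (simp only: interlacing.simps row_weight.simps power_add) auto
qed auto

lemma sum_list_map_nth: "length xs = k \<Longrightarrow> sum_list (map f xs) = (\<Sum>i<k. f (xs ! i))"
  by (simp add: sum_list_sum_nth lessThan_atLeast0)

context
  fixes M n :: nat and Y :: "point set"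
  assumes ladder: "one_sided_ladder M n Y"
begin

text \<open>The paths start in column \<open>n\<close> in the rows \<open>A\<close> and end in row \<open>m\<close> in the columns \<open>d\<close>. They are listed
  from the outermost one, which has the largest starting row and the largest end column.\<close>
definition row_families :: "nat list \<Rightarrow> nat \<Rightarrow> nat list \<Rightarrow> point set list set" where
  "row_families A m d = {Cs. length Cs = length d \<and>
     (\<forall>i<length d. is_path Y (A ! i, n) (m, d ! i) (Cs ! i)) \<and>
     (\<forall>i j. i < j \<longrightarrow> j < length d \<longrightarrow> Cs ! i \<inter> Cs ! j = {})}"

definition row_families_gf :: "nat list \<Rightarrow> nat \<Rightarrow> nat list \<Rightarrow> int poly" where
  "row_families_gf A m d = (\<Sum>Cs\<in>row_families A m d. indet ^ (\<Sum>C\<leftarrow>Cs. card (corners C)))"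

lemma finite_row_families: "finite (row_families A m d)"
proof (rule finite_subset)
  show "row_families A m d \<subseteq> {Cs. set Cs \<subseteq> Pow Y \<and> length Cs = length d}"
    using path_subset by (fastforce simp: row_families_def in_set_conv_nth)
  show "finite {Cs. set Cs \<subseteq> Pow Y \<and> length Cs = length d}"
    by (rule finite_lists_length_eq) (simp add: finite_ladder[OF ladder])
qed

text \<open>A family that ends in row \<open>Suc m\<close> is a family that ends in row \<open>m\<close> in the columns \<open>e\<close>, extended by
  segments of row \<open>Suc m\<close>; it is non-intersecting exactly when the shorter family is and \<open>e\<close> interlaces with
  \<open>d\<close>. The side condition keeps the columns from \<open>y\<close> on free for one more path; \<open>y = Suc n\<close> imposes nothing.\<close>
lemma row_families_gf_next_row_capped:
  assumes A: "\<And>i. i < k \<Longrightarrow> A ! i \<le> m" and d: "d \<in> tuples n k" "dec d"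
  shows "(\<Sum>Cs\<in>{Cs \<in> row_families A (Suc m) d. \<forall>C\<in>set Cs. C \<inter> {Suc m} \<times> {y..n} = {}}.
      indet ^ (\<Sum>C\<leftarrow>Cs. card (corners C))) =
    (\<Sum>e\<in>tuples n k. of_bool (\<forall>z\<in>set e. z < y \<and> (Suc m, z) \<in> Y) * row_weight indet e d * row_families_gf A m e)"
proof -
  define E where "E = {e \<in> tuples n k. interlacing e d \<and> (\<forall>z\<in>set e. z < y \<and> (Suc m, z) \<in> Y)}"
  define glue where "glue = (\<lambda>(e, Cs). map (\<lambda>i. Cs ! i \<union> {Suc m} \<times> {d ! i..e ! i :: nat}) [0..<k])"
  have ld: "length d = k" using d(1) by (rule length_tuples)
  have d_pos: "1 \<le> d ! i" if "i < k" for i using nth_tuples[OF d(1) that] by simp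
  have E: "length e = k" "\<And>i. i < k \<Longrightarrow> d ! i \<le> e ! i"
      "\<And>i j. i < j \<Longrightarrow> j < k \<Longrightarrow> e ! j < d ! i" "\<And>i. i < k \<Longrightarrow> e ! i < y \<and> (Suc m, e ! i) \<in> Y"
    if "e \<in> E" for e
    using that length_tuples[of e] by (auto simp: E_def interlacing_iff_nth ld)
  have fE: "length Cs = k" "\<And>i. i < k \<Longrightarrow> is_path Y (A ! i, n) (m, e ! i) (Cs ! i)"
      "\<And>i j. i < j \<Longrightarrow> j < k \<Longrightarrow> Cs ! i \<inter> Cs ! j = {}"
    if "e \<in> E" "Cs \<in> row_families A m e" for e Cs
    using that(2) E(1)[OF that(1)] by (auto simp: row_families_def)
  have rows: "fst p \<le> m" if "e \<in> E" "Cs \<in> row_families A m e" "i < k" "p \<in> Cs ! i" for e Cs i p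
    using path_rows_le[OF fE(2)[OF that(1-3)] that(4)] .
  have image: "glue ` (SIGMA e:E. row_families A m e) =
      {Cs \<in> row_families A (Suc m) d. \<forall>C\<in>set Cs. C \<inter> {Suc m} \<times> {y..n} = {}}" (is "_ = ?F")
  proof
    show "glue ` (SIGMA e:E. row_families A m e) \<subseteq> ?F"
    proof clarify
      fix e Cs assume e: "e \<in> E" and Cs: "Cs \<in> row_families A m e"
      have disj: "(Cs ! i \<union> {Suc m} \<times> {d ! i..e ! i}) \<inter> (Cs ! j \<union> {Suc m} \<times> {d ! j..e ! j}) = {}"
        if "i < j" "j < k" for i j
        using rows[OF e Cs, of i] rows[OF e Cs, of j] fE(3)[OF e Cs that] E(3)[OF e that] that
        by fastforce
      have path: "is_path Y (A ! i, n) (Suc m, d ! i) (Cs ! i \<union> {Suc m} \<times> {d ! i..e ! i})"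
        if "i < k" for i
        unfolding path_next_row_iff[OF ladder A[OF that]]
        using d_pos[OF that] E(2,4)[OF e that] fE(2)[OF e Cs that] by blast
      have cap: "(Cs ! i \<union> {Suc m} \<times> {d ! i..e ! i}) \<inter> {Suc m} \<times> {y..n} = {}" if "i < k" for i
        using rows[OF e Cs that] E(4)[OF e that] by fastforce
      show "glue (e, Cs) \<in> row_families A (Suc m) d \<and> (\<forall>C\<in>set (glue (e, Cs)). C \<inter> {Suc m} \<times> {y..n} = {})"
        using disj path cap by (simp add: glue_def row_families_def ld)
    qed
    show "?F \<subseteq> glue ` (SIGMA e:E. row_families A m e)"
    proof
      fix Cs assume Cs: "Cs \<in> ?F"
      then have lCs: "length Cs = k" by (simp add: row_families_def ld)
      have path: "is_path Y (A ! i, n) (Suc m, d ! i) (Cs ! i)" if "i < k" for i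
        using Cs that by (simp add: row_families_def ld)
      have disj: "Cs ! i \<inter> Cs ! j = {}" if "i < j" "j < k" for i j
        using Cs that by (simp add: row_families_def ld)
      have cap: "Cs ! i \<inter> {Suc m} \<times> {y..n} = {}" if "i < k" for i
        using Cs that lCs by auto
      have "\<exists>j C'. d ! i \<le> j \<and> (Suc m, j) \<in> Y \<and> is_path Y (A ! i, n) (m, j) C' \<and>
          Cs ! i = C' \<union> {Suc m} \<times> {d ! i..j}" if "i < k" for i
        using path[OF that] unfolding path_next_row_iff[OF ladder A[OF that]] by blast
      then obtain J C' where J: "\<And>i. i < k \<Longrightarrow> d ! i \<le> J i \<and> (Suc m, J i) \<in> Y \<and>
          is_path Y (A ! i, n) (m, J i) (C' i) \<and> Cs ! i = C' i \<union> {Suc m} \<times> {d ! i..J i}"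
        by metis
      define e where "e = map J [0..<k]"
      define Cs' where "Cs' = map C' [0..<k]"
      have le: "length e = k" and e_nth: "\<And>i. i < k \<Longrightarrow> e ! i = J i" by (auto simp: e_def)
      have mem: "(Suc m, x) \<in> Cs ! i" if "i < k" "d ! i \<le> x" "x \<le> J i" for i x
        using J[OF that(1)] that by auto
      have Jn: "1 \<le> J i \<and> J i \<le> n" if "i < k" for i
        using J[OF that] ladder_bounds[OF ladder] by blast
      have Jy: "J i < y" if "i < k" for i
        using mem[OF that, of "J i"] cap[OF that] J[OF that] Jn[OF that] by fastforce
      have lt: "J j < d ! i" if "i < j" "j < k" for i j
      proof (rule ccontr)
        assume "\<not> J j < d ! i"
        moreover have "d ! j < d ! i" using d(2) that by (auto simp: sorted_wrt_iff_nth_less ld)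
        ultimately have "(Suc m, d ! i) \<in> Cs ! j" using mem[of j "d ! i"] that by auto
        moreover have "(Suc m, d ! i) \<in> Cs ! i" using mem[of i "d ! i"] J[of i] that by auto
        ultimately show False using disj[OF that] by auto
      qed
      have "e \<in> E"
        using J Jn Jy lt by (auto simp: E_def tuples_def interlacing_iff_nth le ld e_nth in_set_conv_nth)
      moreover have "Cs' \<in> row_families A m e"
        unfolding row_families_def le
      proof (intro CollectI conjI allI impI)
        fix i j assume "i < j" "j < k"
        with disj[of i j] J[of i] J[of j] show "Cs' ! i \<inter> Cs' ! j = {}" by (auto simp: Cs'_def)
      qed (use J in \<open>auto simp: Cs'_def e_nth\<close>)
      moreover have "Cs = glue (e, Cs')"
        using J by (intro nth_equalityI) (auto simp: glue_def lCs e_nth Cs'_def)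
      ultimately show "Cs \<in> glue ` (SIGMA e:E. row_families A m e)" by blast
    qed
  qed
  have inj: "inj_on glue (SIGMA e:E. row_families A m e)"
  proof (rule inj_onI, clarify)
    fix e Cs e' Cs'
    assume e: "e \<in> E" "Cs \<in> row_families A m e" and e': "e' \<in> E" "Cs' \<in> row_families A m e'"
      and eq: "glue (e, Cs) = glue (e', Cs')"
    have eq_i: "Cs ! i \<union> {Suc m} \<times> {d ! i..e ! i} = Cs' ! i \<union> {Suc m} \<times> {d ! i..e' ! i}" if "i < k" for i
      using arg_cong[OF eq, of "\<lambda>xs. xs ! i"] that by (simp add: glue_def)
    have "Cs ! i = Cs' ! i \<and> e ! i = e' ! i" if "i < k" for i
    proof -
      have r: "\<And>p. p \<in> Cs ! i \<Longrightarrow> fst p \<le> m" "\<And>p. p \<in> Cs' ! i \<Longrightarrow> fst p \<le> m"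
        using rows e e' that by blast+
      have "Cs ! i = {p \<in> Cs ! i \<union> {Suc m} \<times> {d ! i..e ! i}. fst p \<le> m}" using r by auto
      also have "\<dots> = Cs' ! i" unfolding eq_i[OF that] using r by auto
      finally have 1: "Cs ! i = Cs' ! i" .
      have "{d ! i..e ! i} = {x. (Suc m, x) \<in> Cs ! i \<union> {Suc m} \<times> {d ! i..e ! i}}" using r by fastforce
      also have "\<dots> = {d ! i..e' ! i}" unfolding eq_i[OF that] using r by fastforce
      finally show ?thesis using 1 E(2)[OF e(1) that] by auto
    qed
    then show "e = e' \<and> Cs = Cs'"
      using E(1)[OF e(1)] E(1)[OF e'(1)] fE(1)[OF e] fE(1)[OF e'] by (auto intro: nth_equalityI)
  qed
  have weight: "indet ^ (\<Sum>C\<leftarrow>glue (e, Cs). card (corners C)) =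
      row_weight indet e d * indet ^ (\<Sum>C\<leftarrow>Cs. card (corners C))" if "e \<in> E" "Cs \<in> row_families A m e" for e Cs
  proof -
    have "(\<Sum>C\<leftarrow>glue (e, Cs). card (corners C)) =
        (\<Sum>i<k. card (corners (Cs ! i \<union> {Suc m} \<times> {d ! i..e ! i})))"
      by (simp add: glue_def sum_list_map_nth[of _ k] cong: map_cong)
    also have "\<dots> = (\<Sum>i<k. card (corners (Cs ! i)) + of_bool (d ! i < e ! i))"
      using card_corners_next_row[OF ladder fE(2)[OF that] d_pos E(2)[OF that(1)]] by simp
    also have "\<dots> = (\<Sum>C\<leftarrow>Cs. card (corners C)) + (\<Sum>i<k. of_bool (d ! i < e ! i))"
      unfolding sum.distrib sum_list_map_nth[OF fE(1)[OF that]] ..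
    finally show ?thesis
      using that(1) row_weight_eq_power[of e d indet] by (simp only: power_add E_def ld mult.commute) simp
  qed
  have "(\<Sum>Cs\<in>?F. indet ^ (\<Sum>C\<leftarrow>Cs. card (corners C))) =
      (\<Sum>p\<in>(SIGMA e:E. row_families A m e). indet ^ (\<Sum>C\<leftarrow>glue p. card (corners C)))"
    unfolding image[symmetric] using inj by (subst sum.reindex) auto
  also have "\<dots> = (\<Sum>e\<in>E. \<Sum>Cs\<in>row_families A m e. indet ^ (\<Sum>C\<leftarrow>glue (e, Cs). card (corners C)))"
    by (subst sum.Sigma) (auto simp: E_def finite_row_families)
  also have "\<dots> = (\<Sum>e\<in>E. row_weight indet e d * row_families_gf A m e)"
    by (simp add: weight row_families_gf_def sum_distrib_left)
  also have "\<dots> = (\<Sum>e\<in>tuples n k. of_bool (\<forall>z\<in>set e. z < y \<and> (Suc m, z) \<in> Y) *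
      row_weight indet e d * row_families_gf A m e)"
    by (rule sum.mono_neutral_cong_left) (auto simp: E_def row_weight_zero)
  finally show ?thesis .
qed

lemma row_families_gf_next_row:
  assumes A: "\<And>i. i < k \<Longrightarrow> A ! i \<le> m" and d: "d \<in> tuples n k" "dec d"
  shows "row_families_gf A (Suc m) d =
    (\<Sum>e\<in>tuples n k. of_bool (\<forall>z\<in>set e. (Suc m, z) \<in> Y) * row_weight indet e d * row_families_gf A m e)"
proof -
  have "row_families_gf A (Suc m) d =
    (\<Sum>e\<in>tuples n k. of_bool (\<forall>z\<in>set e. z < Suc n \<and> (Suc m, z) \<in> Y) * row_weight indet e d * row_families_gf A m e)"
    using row_families_gf_next_row_capped[OF assms, of "Suc n"] by (simp add: row_families_gf_def)
  also have "(\<lambda>e. \<forall>z\<in>set e. z < Suc n \<and> (Suc m, z) \<in> Y) = (\<lambda>e. \<forall>z\<in>set e. (Suc m, z) \<in> Y)"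
    using ladder_bounds[OF ladder] by (auto simp: less_Suc_eq_le fun_eq_iff)
  finally show ?thesis .
qed

text \<open>The path that starts in the last row is a segment without corners. It affects the others only by
  keeping them out of the columns from \<open>y\<close> on.\<close>
lemma row_families_gf_new_start:
  assumes A: "\<And>i. i < k \<Longrightarrow> A ! i \<le> m" and start: "(Suc m, n) \<in> Y"
    and d: "y # d \<in> tuples n (Suc k)" "dec (y # d)"
  shows "row_families_gf (Suc m # A) (Suc m) (y # d) =
    (\<Sum>e\<in>tuples n k. of_bool (\<forall>z\<in>set e. z < y) * row_weight indet e d * row_families_gf A m e)"
proof -
  have y: "1 \<le> y" "y \<le> n" and d': "d \<in> tuples n k" "dec d" using d by (auto simp: Cons_in_tuples_iff)
  let ?C = "{Suc m} \<times> {y..n}"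
  have path: "is_path Y (Suc m, n) (Suc m, y) C \<longleftrightarrow> C = ?C" for C
    using path_in_row_iff[OF ladder] start y by blast
  have "row_families (Suc m # A) (Suc m) (y # d) =
      (#) ?C ` {Cs \<in> row_families A (Suc m) d. \<forall>C\<in>set Cs. C \<inter> ?C = {}}" (is "_ = _ ` ?F")
  proof (intro equalityI subsetI)
    fix Cs assume "Cs \<in> row_families (Suc m # A) (Suc m) (y # d)"
    then have len: "length Cs = Suc (length d)"
      and p: "\<And>i. i < Suc (length d) \<Longrightarrow> is_path Y ((Suc m # A) ! i, n) (Suc m, (y # d) ! i) (Cs ! i)"
      and dj: "\<And>i j. i < j \<Longrightarrow> j < Suc (length d) \<Longrightarrow> Cs ! i \<inter> Cs ! j = {}"
      by (auto simp: row_families_def)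
    obtain C Cs' where Cs: "Cs = C # Cs'" using len by (cases Cs) auto
    have C: "C = ?C" using p[of 0] path Cs by simp
    have "Cs' \<in> row_families A (Suc m) d"
      using len p[of "Suc _"] dj[of "Suc _" "Suc _"] by (simp add: row_families_def Cs)
    moreover have "C' \<inter> ?C = {}" if C': "C' \<in> set Cs'" for C'
    proof -
      obtain j where "j < length d" "C' = Cs' ! j" using C' len by (auto simp: Cs in_set_conv_nth)
      then show ?thesis using dj[of 0 "Suc j"] C by (auto simp: Cs)
    qed
    ultimately show "Cs \<in> (#) ?C ` ?F" using Cs C by auto
  next
    fix Cs assume "Cs \<in> (#) ?C ` ?F"
    then obtain Cs' where Cs: "Cs = ?C # Cs'" "Cs' \<in> row_families A (Suc m) d" "\<forall>C\<in>set Cs'. C \<inter> ?C = {}" by auto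
    have len: "length Cs' = length d" using Cs(2) by (simp add: row_families_def)
    show "Cs \<in> row_families (Suc m # A) (Suc m) (y # d)"
      unfolding row_families_def
    proof (intro CollectI conjI allI impI)
      fix i assume "i < length (y # d)"
      then show "is_path Y ((Suc m # A) ! i, n) (Suc m, (y # d) ! i) (Cs ! i)"
        using Cs path by (cases i) (auto simp: row_families_def)
    next
      fix i j assume ij: "i < j" "j < length (y # d)"
      then obtain j' where j: "j = Suc j'" by (cases j) auto
      show "Cs ! i \<inter> Cs ! j = {}"
      proof (cases i)
        case 0
        with ij Cs(3) len nth_mem[of j' Cs'] show ?thesis by (auto simp: Cs(1) j)
      next
        case (Suc i')
        with ij Cs(2) show ?thesis by (simp add: row_families_def Cs(1) j)
      qed
    qed (use len Cs in simp)
  qed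
  then have "row_families_gf (Suc m # A) (Suc m) (y # d) =
      (\<Sum>Cs\<in>?F. indet ^ (\<Sum>C\<leftarrow>?C # Cs. card (corners C)))"
    unfolding row_families_gf_def by (simp only: sum.reindex[OF inj_on_Cons1] o_def)
  also have "\<dots> = (\<Sum>Cs\<in>?F. indet ^ (\<Sum>C\<leftarrow>Cs. card (corners C)))"
    by (simp only: list.map sum_list.Cons corners_row card.empty add_0)
  also have "\<dots> = (\<Sum>e\<in>tuples n k. of_bool (\<forall>z\<in>set e. z < y \<and> (Suc m, z) \<in> Y) * row_weight indet e d * row_families_gf A m e)"
    by (rule row_families_gf_next_row_capped[OF A d'])
  also have "\<dots> = (\<Sum>e\<in>tuples n k. of_bool (\<forall>z\<in>set e. z < y) * row_weight indet e d * row_families_gf A m e)"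
  proof (intro sum.cong refl arg_cong[where f = "\<lambda>s. of_bool s * _ * _"])
    fix e assume "e \<in> tuples n k"
    then have "(Suc m, z) \<in> Y" if "z \<in> set e" for z
      using ladder_down[OF ladder start, of "Suc m" z] that by (auto simp: tuples_def)
    then show "(\<forall>z\<in>set e. z < y \<and> (Suc m, z) \<in> Y) \<longleftrightarrow> (\<forall>z\<in>set e. z < y)" by auto
  qed
  finally show ?thesis .
qed

end

section \<open>The determinant of path generating functions\<close>

lemma Sum_any_monom_card:
  assumes "finite S"
  shows "Sum_any (\<lambda>k. monom (int (card {x \<in> S. f x = k})) k) = (\<Sum>x\<in>S. indet ^ f x)"
proof -
  have pow: "indet ^ k = monom 1 k" for k
    by (simp add: indet_def monom_power)
  have "Sum_any (\<lambda>k. monom (int (card {x \<in> S. f x = k})) k) =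
      (\<Sum>k\<in>f ` S. monom (int (card {x \<in> S. f x = k})) k)"
  proof (rule Sum_any.expand_superset)
    show "{k. monom (int (card {x \<in> S. f x = k})) k \<noteq> 0} \<subseteq> f ` S"
      using assms by (auto simp: card_eq_0_iff)
  qed (use assms in simp)
  also have "\<dots> = (\<Sum>k\<in>f ` S. \<Sum>x\<in>{x \<in> S. f x = k}. indet ^ f x)"
    by (intro sum.cong refl) (simp add: pow of_nat_poly smult_monom)
  also have "\<dots> = (\<Sum>x\<in>S. indet ^ f x)"
    using assms by (intro sum.group) auto
  finally show ?thesis .
qed

lemma path_gf_eq_sum:
  assumes "finite Y"
  shows "path_gf Y P Q = (\<Sum>C | is_path Y P Q C. indet ^ card (corners C))"
  using Sum_any_monom_card[of "{C. is_path Y P Q C}" "\<lambda>C. card (corners C)", OF finite_paths[OF assms]]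
  by (simp add: path_gf_def path_count_def)

text \<open>The coefficient of \<open>E^q\<close> in \<open>(1 - t + t E)^s\<close>.\<close>
fun reach_coeff :: "'a :: comm_ring_1 \<Rightarrow> nat \<Rightarrow> nat \<Rightarrow> 'a" where
  "reach_coeff t 0 q = of_bool (q = 0)"
| "reach_coeff t (Suc s) 0 = (1 - t) * reach_coeff t s 0"
| "reach_coeff t (Suc s) (Suc q) = (1 - t) * reach_coeff t s (Suc q) + t * reach_coeff t s q"

lemma reach_coeff_above: "s < q \<Longrightarrow> reach_coeff t s q = 0"
  by (induction t s q rule: reach_coeff.induct) auto

lemma reach_coeff_diag: "reach_coeff t s s = t ^ s"
  by (induction s) (auto simp: reach_coeff_above)

lemma sum_lessThan_id: "(\<Sum>i<r. i) = r choose 2"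
  by (induction r) (auto simp: numeral_2_eq_2)

context
  fixes M n :: nat and Y :: "point set"
  assumes ladder: "one_sided_ladder M n Y"
begin

lemma row_families_gf_single: "row_families_gf n Y [a] m [x] = path_gf Y (a, n) (m, x)"
proof -
  have "row_families n Y [a] m [x] = (\<lambda>C. [C]) ` {C. is_path Y (a, n) (m, x) C}"
    by (auto simp: row_families_def[OF ladder] length_Suc_conv image_iff)
  then show ?thesis
    unfolding row_families_gf_def[OF ladder] path_gf_eq_sum[OF finite_ladder[OF ladder]]
    by (simp add: sum.reindex inj_on_def)
qed

lemma path_gf_next_row:
  assumes "a \<le> m" "x \<in> {1..n}"
  shows "path_gf Y (a, n) (Suc m, x) =
    (\<Sum>p\<in>{x..n}. (if p = x then 1 else indet) * (of_bool ((Suc m, p) \<in> Y) * path_gf Y (a, n) (m, p)))"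
proof -
  have "path_gf Y (a, n) (Suc m, x) = (\<Sum>e\<in>tuples n (Suc 0). of_bool (\<forall>z\<in>set e. (Suc m, z) \<in> Y) *
      row_weight indet e [x] * row_families_gf n Y [a] m e)"
    unfolding row_families_gf_single[symmetric]
    by (rule row_families_gf_next_row[OF ladder]) (use assms in \<open>auto simp: tuples_def\<close>)
  also have "\<dots> = (\<Sum>p\<in>{1..n}. of_bool ((Suc m, p) \<in> Y) * row_weight indet [p] [x] * path_gf Y (a, n) (m, p))"
    by (simp add: sum_tuples_Suc tuples_0 row_families_gf_single del: row_weight.simps)
  also have "\<dots> = (\<Sum>p\<in>{x..n}. (if p = x then 1 else indet) * (of_bool ((Suc m, p) \<in> Y) * path_gf Y (a, n) (m, p)))"
    by (rule sum.mono_neutral_cong_right) (use assms(2) in auto)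
  finally show ?thesis .
qed

lemma path_gf_in_row:
  assumes "(a, n) \<in> Y" "x \<in> {1..n}"
  shows "path_gf Y (a, n) (a, x) = 1"
proof -
  have "a = Suc (a - 1)" using ladder_bounds[OF ladder assms(1)] by simp
  then have "corners ({a} \<times> B) = {}" for B using corners_row by metis
  then show ?thesis
    using assms by (simp add: path_gf_eq_sum[OF finite_ladder[OF ladder]] path_in_row_iff[OF ladder])
qed

text \<open>Crossing a row all of whose columns lie in the ladder is the operator \<open>1 - t + t E\<close>, where \<open>E\<close> is
  suffix summation, and in its first row a path reaches each column once without corners.\<close>
lemma path_gf_full_rows:
  assumes "1 \<le> a" "(a + s, n) \<in> Y" "x \<in> {1..n}" "s < N"
  shows "path_gf Y (a, n) (a + s, x) = (\<Sum>q<N. reach_coeff indet s q * iterated_sum n (Suc q) x)"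
  using assms
proof (induction s arbitrary: x N)
  case 0
  then have "(\<Sum>q<N. reach_coeff indet 0 q * iterated_sum n (Suc q) x) =
      (\<Sum>q\<in>{0}. reach_coeff indet 0 q * iterated_sum n (Suc q) x)"
    by (intro sum.mono_neutral_right) auto
  also have "\<dots> = 1" using 0 by simp
  finally show ?case using path_gf_in_row[of a x] 0 by simp
next
  case (Suc s)
  obtain N' where N: "N = Suc N'" "s < N'" using Suc.prems by (cases N) auto
  have Y: "(Suc (a + s), p) \<in> Y" if "p \<in> {1..n}" for p
    using Suc.prems that by (auto intro: ladder_down[OF ladder, of "a + Suc s" n])
  have full: "(a + s, n) \<in> Y"
    using Suc.prems by (auto intro: ladder_down[OF ladder, of "a + Suc s" n])
  have IH: "path_gf Y (a, n) (a + s, p) = (\<Sum>q<L. reach_coeff indet s q * iterated_sum n (Suc q) p)"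
    if "p \<in> {1..n}" "s < L" for p L
    using Suc.IH[OF Suc.prems(1) full that] .
  have "path_gf Y (a, n) (a + Suc s, x) = (\<Sum>p\<in>{x..n}. (if p = x then 1 else indet) *
      (of_bool ((Suc (a + s), p) \<in> Y) * path_gf Y (a, n) (a + s, p)))"
    using path_gf_next_row[of a "a + s" x] Suc.prems(3) by simp
  also have "\<dots> = (\<Sum>p\<in>{x..n}. (if p = x then 1 else indet) * path_gf Y (a, n) (a + s, p))"
    by (rule sum.cong[OF refl]) (use Y Suc.prems(3) in auto)
  also have "\<dots> = (1 - indet) * path_gf Y (a, n) (a + s, x) + indet * (\<Sum>p\<in>{x..n}. path_gf Y (a, n) (a + s, p))"
  proof -
    have "{x..n} = insert x {Suc x..n}" using Suc.prems(3) by auto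
    then show ?thesis by (simp add: sum_distrib_left algebra_simps)
  qed
  also have "(\<Sum>p\<in>{x..n}. path_gf Y (a, n) (a + s, p)) =
      (\<Sum>p\<in>{x..n}. \<Sum>q<N'. reach_coeff indet s q * iterated_sum n (Suc q) p)"
    by (intro sum.cong refl IH) (use Suc.prems(3) N in auto)
  also have "\<dots> = (\<Sum>q<N'. reach_coeff indet s q * iterated_sum n (Suc (Suc q)) x)"
    by (subst sum.swap) (simp add: sum_distrib_left)
  also have "path_gf Y (a, n) (a + s, x) = (\<Sum>q<Suc N'. reach_coeff indet s q * iterated_sum n (Suc q) x)"
    by (rule IH) (use Suc.prems(3) N in auto)
  also have "(1 - indet) * \<dots> + indet * (\<Sum>q<N'. reach_coeff indet s q * iterated_sum n (Suc (Suc q)) x) =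
      (\<Sum>q<Suc N'. reach_coeff indet (Suc s) q * iterated_sum n (Suc q) x)"
    unfolding sum.lessThan_Suc_shift
    by (simp only: reach_coeff.simps distrib_left distrib_right sum.distrib sum_distrib_left mult.assoc add.assoc)
  finally show ?case unfolding N .
qed

text \<open>When the \<open>i + 1\<close>st path enters, the largest entry \<open>y\<close> of \<open>d\<close> is its end column, and \<open>A_kernel\<close> acts on
  the other entries as \<open>lower\<close> followed by \<open>A_kernel\<close>. Together with the transfer \<open>row_weight\<close> of the older
  paths this is the right-hand side of \<open>A_kernel_interlacing\<close>. The resulting recursion is that of
  \<open>column_det_iterated_sum_Cons\<close>.\<close>
lemma row_families_gf_A_kernel_first_rows:
  assumes "i = 0 \<or> (i, n) \<in> Y" "d \<in> tuples n i" "dec d"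
  shows "(\<Sum>e\<in>tuples n i. row_families_gf n Y (rev [1..<Suc i]) i e * A_kernel indet n e d) =
    column_det (\<lambda>s. iterated_sum n (Suc s)) d"
  using assms
proof (induction i arbitrary: d)
  case 0
  have "row_families n Y [] 0 [] = {[]}" by (auto simp: row_families_def[OF ladder])
  with 0 show ?case by (simp add: tuples_0 column_det_def row_families_gf_def[OF ladder])
next
  case (Suc i)
  obtain y d' where d: "d = y # d'" and y: "y \<in> {1..n}" "d' \<in> tuples n i" "dec d'"
    using Suc.prems by (auto simp: tuples_Suc)
  have start: "(Suc i, n) \<in> Y" using Suc.prems by simp
  have Y: "i = 0 \<or> (i, n) \<in> Y"
    using ladder_down[OF ladder start, of i n] ladder_bounds[OF ladder start] by (cases "i = 0") auto
  let ?A = "rev [1..<Suc i]"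
  let ?F = "row_families_gf n Y ?A i"
  have A: "?A ! l \<le> i" if "l < i" for l
    using that by (simp add: rev_nth del: upt_Suc)
  have A_Suc: "rev [1..<Suc (Suc i)] = Suc i # ?A" by simp
  define H where "H e = (\<Sum>h\<in>tuples n i. lower indet e h * A_kernel indet n h d')" for e
  have "(\<Sum>e\<in>tuples n (Suc i). row_families_gf n Y (rev [1..<Suc (Suc i)]) (Suc i) e * A_kernel indet n e d) =
    (\<Sum>p\<in>{1..n}. if p = y then \<Sum>e\<in>tuples n i.
       row_families_gf n Y (Suc i # ?A) (Suc i) (y # e) * A_kernel indet n (y # e) d else 0)"
    unfolding sum_tuples_Suc A_Suc by (intro sum.cong refl) (auto simp: d)
  also have "\<dots> = (\<Sum>e\<in>tuples n i. row_families_gf n Y (Suc i # ?A) (Suc i) (y # e) * A_kernel indet n (y # e) d)"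
    using y by simp
  also have "\<dots> = (\<Sum>e\<in>tuples n i. (\<Sum>g\<in>tuples n i.
      of_bool (\<forall>z\<in>set g. z < y) * row_weight indet g e * ?F g) * H e)"
  proof (rule sum.cong[OF refl])
    fix e assume e: "e \<in> tuples n i"
    show "row_families_gf n Y (Suc i # ?A) (Suc i) (y # e) * A_kernel indet n (y # e) d =
      (\<Sum>g\<in>tuples n i. of_bool (\<forall>z\<in>set g. z < y) * row_weight indet g e * ?F g) * H e"
    proof (cases "dec (y # e)")
      case True
      have "row_families_gf n Y (Suc i # ?A) (Suc i) (y # e) =
          (\<Sum>g\<in>tuples n i. of_bool (\<forall>z\<in>set g. z < y) * row_weight indet g e * ?F g)"
        by (rule row_families_gf_new_start[OF ladder A start _ True]) (use e y in \<open>auto simp: Cons_in_tuples_iff\<close>)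
      moreover have "A_kernel indet n (y # e) d = H e"
        using True length_tuples[OF e] by (simp add: d H_def)
      ultimately show ?thesis by simp
    next
      case False
      have "of_bool (\<forall>z\<in>set g. z < y) * row_weight indet g e * ?F g = 0" for g
      proof (cases "interlacing g e \<and> (\<forall>z\<in>set g. z < y)")
        case True
        then have "dec (y # e)" using interlacing_dec_right[of g e] interlacing_bound[of g e y] by auto
        with False show ?thesis by simp
      qed (auto simp: row_weight_zero)
      then have "(\<Sum>g\<in>tuples n i. of_bool (\<forall>z\<in>set g. z < y) * row_weight indet g e * ?F g) = 0"
        by (intro sum.neutral) blast
      moreover have "A_kernel indet n (y # e) d = 0" using False A_kernel_nonzero_dec by blast
      ultimately show ?thesis by simp
    qed
  qed
  also have "\<dots> = (\<Sum>g\<in>tuples n i. of_bool (\<forall>z\<in>set g. z < y) * ?F g *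
      (\<Sum>e\<in>tuples n i. \<Sum>h\<in>tuples n i. row_weight indet g e * lower indet e h * A_kernel indet n h d'))"
    unfolding H_def sum_distrib_right
    by (subst sum.swap) (simp only: sum_distrib_left mult_ac)
  also have "\<dots> = (\<Sum>g\<in>tuples n i. of_bool (\<forall>z\<in>set g. z < y) * ?F g *
      (\<Sum>c\<in>tuples n i. A_kernel indet n g c * of_bool (interlacing c d')))"
    by (intro sum.cong refl arg_cong[where f = "\<lambda>s. _ * s"] A_kernel_interlacing[symmetric] y(2))
  also have "\<dots> = (\<Sum>c\<in>tuples n i. \<Sum>g\<in>tuples n i. of_bool (\<forall>z\<in>set g. z < y) * ?F g *
      (A_kernel indet n g c * of_bool (interlacing c d')))"
    unfolding sum_distrib_left by (rule sum.swap)
  also have "\<dots> = (\<Sum>c\<in>tuples n i. of_bool (interlacing c d' \<and> (\<forall>z\<in>set c. z < y)) *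
      column_det (\<lambda>s. iterated_sum n (Suc s)) c)"
  proof (rule sum.cong[OF refl])
    fix c assume c: "c \<in> tuples n i"
    have "(\<Sum>g\<in>tuples n i. of_bool (\<forall>z\<in>set g. z < y) * ?F g * (A_kernel indet n g c * of_bool (interlacing c d'))) =
      (\<Sum>g\<in>tuples n i. of_bool (interlacing c d' \<and> (\<forall>z\<in>set c. z < y)) * (?F g * A_kernel indet n g c))"
    proof (rule sum.cong[OF refl])
      fix g
      show "of_bool (\<forall>z\<in>set g. z < y) * ?F g * (A_kernel indet n g c * of_bool (interlacing c d')) =
        of_bool (interlacing c d' \<and> (\<forall>z\<in>set c. z < y)) * (?F g * A_kernel indet n g c)"
        using A_kernel_bound_iff[of indet n g c y] by (cases "A_kernel indet n g c = 0") (auto simp: mult_ac)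
    qed
    also have "\<dots> = of_bool (interlacing c d' \<and> (\<forall>z\<in>set c. z < y)) * (\<Sum>g\<in>tuples n i. ?F g * A_kernel indet n g c)"
      by (rule sum_distrib_left[symmetric])
    also have "\<dots> = of_bool (interlacing c d' \<and> (\<forall>z\<in>set c. z < y)) * column_det (\<lambda>s. iterated_sum n (Suc s)) c"
    proof (cases "interlacing c d'")
      case True
      show ?thesis unfolding Suc.IH[OF Y c interlacing_dec_left[OF True]] ..
    qed simp
    finally show "(\<Sum>g\<in>tuples n i. of_bool (\<forall>z\<in>set g. z < y) * ?F g * (A_kernel indet n g c * of_bool (interlacing c d'))) = \<dots>" .
  qed
  also have "\<dots> = column_det (\<lambda>s. iterated_sum n (Suc s)) d"
    unfolding d by (rule column_det_iterated_sum_Cons[symmetric]) (use Suc.prems d in auto)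
  finally show ?case .
qed

lemma row_of_ladder_initial: "\<exists>y. \<forall>z\<in>{1..n}. (m, z) \<in> Y \<longleftrightarrow> z < y"
proof -
  define y where "y = (LEAST z. 1 \<le> z \<and> (m, z) \<notin> Y)"
  have ex: "1 \<le> Suc n \<and> (m, Suc n) \<notin> Y" using ladder_bounds[OF ladder, of m "Suc n"] by auto
  have y: "1 \<le> y \<and> (m, y) \<notin> Y" unfolding y_def by (rule LeastI[of _ "Suc n"]) (rule ex)
  have "(m, z) \<in> Y \<longleftrightarrow> z < y" if "z \<in> {1..n}" for z
  proof
    assume z: "(m, z) \<in> Y"
    show "z < y"
    proof (rule ccontr)
      assume "\<not> z < y"
      then have "(m, y) \<in> Y" using ladder_down[OF ladder z, of m y] ladder_bounds[OF ladder z] y by simp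
      with y show False by simp
    qed
  next
    assume "z < y"
    then show "(m, z) \<in> Y" using not_less_Least[of z "\<lambda>z. 1 \<le> z \<and> (m, z) \<notin> Y"] that by (auto simp: y_def)
  qed
  then show ?thesis by blast
qed

text \<open>The determinantal identity before the coefficients \<open>A\<close> are identified, for end points in any row
  from \<open>r\<close> on. Row \<open>r\<close> is settled by row operations, and \<open>A_kernel_intertwines\<close> carries the identity from
  one row to the next.\<close>
lemma column_det_path_gf:
  assumes start: "(r, n) \<in> Y" and d: "d \<in> tuples n r" "dec d"
  shows "column_det (\<lambda>i x. path_gf Y (r - i, n) (r + s, x)) d =
    indet ^ (r choose 2) * (\<Sum>e\<in>tuples n r. row_families_gf n Y (rev [1..<Suc r]) (r + s) e * A_kernel indet n e d)"
  using d
proof (induction s arbitrary: d)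
  case 0
  have len: "length d = r" using 0 by (simp add: tuples_def)
  have "column_det (\<lambda>i x. path_gf Y (r - i, n) (r + 0, x)) d =
      column_det (\<lambda>i x. \<Sum>q<length d. reach_coeff indet i q * iterated_sum n (Suc q) x) d"
  proof (rule column_det_cong)
    fix i x assume "i < length d" "x \<in> set d"
    then show "path_gf Y (r - i, n) (r + 0, x) = (\<Sum>q<length d. reach_coeff indet i q * iterated_sum n (Suc q) x)"
      using path_gf_full_rows[of "r - i" i x r] 0 start by (auto simp: len tuples_def subset_iff)
  qed
  also have "\<dots> = (\<Prod>i<length d. reach_coeff indet i i) * column_det (\<lambda>s. iterated_sum n (Suc s)) d"
    by (rule column_det_lower_triangular) (rule reach_coeff_above)
  also have "(\<Prod>i<length d. reach_coeff indet i i) = indet ^ (r choose 2)"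
    by (simp only: reach_coeff_diag len power_sum[symmetric] sum_lessThan_id)
  also have "column_det (\<lambda>s. iterated_sum n (Suc s)) d =
      (\<Sum>e\<in>tuples n r. row_families_gf n Y (rev [1..<Suc r]) r e * A_kernel indet n e d)"
    using row_families_gf_A_kernel_first_rows[of r d] start 0 by simp
  finally show ?case by simp
next
  case (Suc s)
  let ?m = "r + s"
  let ?F = "row_families_gf n Y (rev [1..<Suc r])"
  define R where "R e = (\<Sum>c\<in>tuples n r. of_bool (interlacing e c) * diff_weight indet c d)" for e
  obtain y where y: "\<And>z. z \<in> {1..n} \<Longrightarrow> (Suc ?m, z) \<in> Y \<longleftrightarrow> z < y"
    using row_of_ladder_initial by blast
  \<comment> \<open>As an upper bound on the entries, this condition passes from \<open>e\<close> to \<open>g\<close> through \<open>A_kernel\<close>.\<close>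
  define ok where "ok e \<longleftrightarrow> (\<forall>z\<in>set e. (Suc ?m, z) \<in> Y)" for e
  have ok: "ok e \<longleftrightarrow> (\<forall>z\<in>set e. z < y)" if "e \<in> tuples n r" for e
    using that y by (auto simp: ok_def tuples_def subset_iff)
  let ?g = "\<lambda>i p. of_bool ((Suc ?m, p) \<in> Y) * path_gf Y (r - i, n) (?m, p)"
  have "column_det (\<lambda>i x. path_gf Y (r - i, n) (r + Suc s, x)) d =
      column_det (\<lambda>i x. \<Sum>p\<in>{x..n}. (if p = x then 1 else indet) * ?g i p) d"
  proof (rule column_det_cong)
    fix i x assume "x \<in> set d"
    then have "x \<in> {1..n}" using Suc.prems by (auto simp: tuples_def)
    then show "path_gf Y (r - i, n) (r + Suc s, x) = (\<Sum>p\<in>{x..n}. (if p = x then 1 else indet) * ?g i p)"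
      using path_gf_next_row[of "r - i" ?m x] by simp
  qed
  also have "\<dots> = (\<Sum>e\<in>tuples n r. column_det ?g e * R e)"
    unfolding R_def by (rule column_det_row_transfer[OF Suc.prems])
  also have "\<dots> = (\<Sum>e\<in>tuples n r. \<Sum>g\<in>tuples n r.
      indet ^ (r choose 2) * (of_bool (ok g) * ?F ?m g * (A_kernel indet n g e * R e)))"
  proof (rule sum.cong[OF refl])
    fix e assume e: "e \<in> tuples n r"
    show "column_det ?g e * R e = (\<Sum>g\<in>tuples n r.
      indet ^ (r choose 2) * (of_bool (ok g) * ?F ?m g * (A_kernel indet n g e * R e)))"
    proof (cases "dec e")
      case True
      have "column_det ?g e = of_bool (ok e) * column_det (\<lambda>i x. path_gf Y (r - i, n) (?m, x)) e"
      proof (cases "ok e")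
        case True
        then have "column_det ?g e = column_det (\<lambda>i x. path_gf Y (r - i, n) (?m, x)) e"
          by (intro column_det_cong) (simp add: ok_def)
        with True show ?thesis by simp
      next
        case False
        then obtain z where "z \<in> set e" "(Suc ?m, z) \<notin> Y" by (auto simp: ok_def)
        then have "column_det ?g e = 0" by (intro column_det_zero_column[of z]) auto
        with False show ?thesis by simp
      qed
      also have "\<dots> = (\<Sum>g\<in>tuples n r. of_bool (ok e) * (indet ^ (r choose 2) * (?F ?m g * A_kernel indet n g e)))"
        unfolding Suc.IH[OF e True] sum_distrib_left ..
      also have "\<dots> = (\<Sum>g\<in>tuples n r. indet ^ (r choose 2) * (of_bool (ok g) * ?F ?m g * A_kernel indet n g e))"
      proof (rule sum.cong[OF refl])
        fix g assume g: "g \<in> tuples n r"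
        show "of_bool (ok e) * (indet ^ (r choose 2) * (?F ?m g * A_kernel indet n g e)) =
            indet ^ (r choose 2) * (of_bool (ok g) * ?F ?m g * A_kernel indet n g e)"
          using A_kernel_bound_iff[of indet n g e y] ok[OF g] ok[OF e] by (cases "A_kernel indet n g e = 0") auto
      qed
      finally show ?thesis by (simp only: sum_distrib_right mult.assoc)
    next
      case False
      then have "\<not> interlacing e c" for c using interlacing_dec_left by blast
      then have "R e = 0" by (simp add: R_def)
      then show ?thesis by simp
    qed
  qed
  also have "\<dots> = indet ^ (r choose 2) * (\<Sum>g\<in>tuples n r. of_bool (ok g) * ?F ?m g * (\<Sum>e\<in>tuples n r. A_kernel indet n g e * R e))"
    unfolding sum_distrib_left by (rule sum.swap)
  also have "\<dots> = indet ^ (r choose 2) * (\<Sum>g\<in>tuples n r. of_bool (ok g) * ?F ?m g *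
      (\<Sum>h\<in>tuples n r. row_weight indet g h * A_kernel indet n h d))"
    unfolding R_def
    by (intro sum.cong refl arg_cong[where f = "\<lambda>s. _ * s"] A_kernel_intertwines Suc.prems)
  also have "\<dots> = indet ^ (r choose 2) * (\<Sum>h\<in>tuples n r. (\<Sum>g\<in>tuples n r. of_bool (ok g) * row_weight indet g h * ?F ?m g) *
      A_kernel indet n h d)"
    unfolding sum_distrib_left[of "of_bool _ * _"] sum_distrib_right
    by (subst sum.swap) (simp only: mult_ac)
  also have "\<dots> = indet ^ (r choose 2) * (\<Sum>h\<in>tuples n r. ?F (Suc ?m) h * A_kernel indet n h d)"
  proof (intro sum.cong refl arg_cong[where f = "\<lambda>s. _ * s"])
    fix h assume h: "h \<in> tuples n r"
    show "(\<Sum>g\<in>tuples n r. of_bool (ok g) * row_weight indet g h * ?F ?m g) * A_kernel indet n h d =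
      ?F (Suc ?m) h * A_kernel indet n h d"
    proof (cases "A_kernel indet n h d = 0")
      case False
      have "rev [1..<Suc r] ! i \<le> ?m" if "i < r" for i
        using that by (simp add: rev_nth del: upt_Suc)
      then show ?thesis
        using row_families_gf_next_row[OF ladder, of r "rev [1..<Suc r]" ?m h] h A_kernel_nonzero_dec[OF False]
        by (simp only: ok_def) 
    qed simp
  qed
  finally show ?case by simp
qed

end

section \<open>The coefficients A\<close>

lemma lower_eq:
  "lower t a e = (if list_all2 (\<le>) e a then (1 - t) ^ (sum_list a - sum_list e) else 0)"
proof (induction a e rule: interlacing.induct)
  case (2 x a p e)
  have "sum_list e \<le> sum_list a" if "list_all2 (\<le>) e a"
    using that by (induction e a rule: list_all2_induct) auto
  then have "p \<le> x \<Longrightarrow> list_all2 (\<le>) e a \<Longrightarrow>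
      sum_list (x # a) - sum_list (p # e) = (x - p) + (sum_list a - sum_list e)"
    by simp
  then show ?case unfolding lower.simps list_all2_Cons 2
    by (cases "p \<le> x"; cases "list_all2 (\<le>) e a")
      (simp_all only: if_True if_False simp_thms power_add mult_zero_right)
qed auto

lemma rev_inc_seqs_iff: "rev c \<in> tuples n l \<and> dec (rev c) \<longleftrightarrow> c \<in> inc_seqs l \<and> set c \<subseteq> {..n}"
proof -
  have "{1..n} = {..n} - {0}" by auto
  then show ?thesis by (auto simp: tuples_def inc_seqs_def sorted_wrt_rev subset_Diff_insert)
qed

lemma coeff_A_last:
  assumes "coeff_A b c \<noteq> 0"
  shows "c ! (length b - 1) = b ! (length b - 1)"
  using assms by (subst (asm) coeff_A.simps) (auto simp: Let_def split: if_splits)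

lemma A_kernel_single: "A_kernel t n [x] [y] = of_bool (x = y)"
  by (simp add: tuples_0)

lemma coeff_A_pair: "coeff_A [b0, b1] [c0, c1] = of_bool (b1 = c1 \<and> b0 \<le> c0)"
  by (subst coeff_A.simps) simp

lemma coeff_A_snoc:
  assumes "length b = l" "length c = l" "2 \<le> l"
  shows "coeff_A (b @ [x]) (c @ [z]) = (if x = z then
    \<Sum>c'\<in>{c' \<in> inc_seqs l. \<forall>i<l. c' ! i \<le> c ! i}. coeff_A b c' else 0)"
proof -
  have "{c' \<in> inc_seqs l. \<forall>i<l. c' ! i \<le> (c @ [z]) ! i} = {c' \<in> inc_seqs l. \<forall>i<l. c' ! i \<le> c ! i}"
    using assms by (auto simp: nth_append)
  then show ?thesis
    using assms by (subst coeff_A.simps) (auto simp: Let_def nth_append)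
qed

lemma inc_seqs_snocD:
  assumes "b \<in> inc_seqs (Suc l)"
  obtains b' x where "b = b' @ [x]" "b' \<in> inc_seqs l" "length b' = l"
  using assms by (cases b rule: rev_cases) (auto simp: inc_seqs_def sorted_wrt_append)

text \<open>The recursion for \<open>A\<close> sums over the increasing sequences below \<open>c\<close>, which are the tuples that \<open>lower\<close>
  reaches, and the powers of \<open>1 - t\<close> along the way add up to the difference of the sums of the entries.
  The inequality ensures that the truncated subtractions are harmless.\<close>
lemma A_kernel_eq_coeff_A:
  fixes t :: "'a :: comm_ring_1"
  assumes "2 \<le> l" "b \<in> inc_seqs l" "c \<in> inc_seqs l" "set c \<subseteq> {..n}"
  shows "A_kernel t n (rev c) (rev b) = of_int (coeff_A b c) * (1 - t) ^ (sum_list c - sum_list b) \<and>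
    (coeff_A b c \<noteq> 0 \<longrightarrow> sum_list b \<le> sum_list c)"
  using assms
proof (induction l arbitrary: b c rule: nat_induct_at_least)
  case base
  obtain b0 b1 c0 c1 where bc: "b = [b0, b1]" "c = [c0, c1]"
    using base by (auto simp: inc_seqs_def numeral_2_eq_2 length_Suc_conv)
  have "(\<Sum>e\<in>tuples n (Suc 0). lower t [c0] e * A_kernel t n e [b0]) =
      (\<Sum>p\<in>{1..n}. if p = b0 then lower t [c0] [b0] else 0)"
    unfolding sum_tuples_Suc by (intro sum.cong refl) (simp add: tuples_0 A_kernel_single del: A_kernel.simps)
  also have "\<dots> = (if b0 \<le> c0 then (1 - t) ^ (c0 - b0) else 0)"
    using base by (auto simp: inc_seqs_def bc)
  finally show ?case
    using base by (auto simp: bc coeff_A_pair inc_seqs_def)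
next
  case (Suc l)
  obtain b' x where b: "b = b' @ [x]" "b' \<in> inc_seqs l" "length b' = l"
    using inc_seqs_snocD[OF Suc.prems(1)] .
  obtain c' z where c: "c = c' @ [z]" "c' \<in> inc_seqs l" "length c' = l"
    using inc_seqs_snocD[OF Suc.prems(2)] .
  let ?I = "{c'' \<in> inc_seqs l. \<forall>i<l. c'' ! i \<le> c' ! i}"
  have dec: "dec (rev c)" using Suc.prems rev_inc_seqs_iff by blast
  have le_iff: "(\<forall>i<l. e ! i \<le> c' ! i) \<longleftrightarrow> list_all2 (\<le>) (rev e) (rev c')" if "e \<in> inc_seqs l" for e
    unfolding list_all2_rev1 rev_rev_ident
    using that c by (simp add: list_all2_conv_all_nth inc_seqs_def)
  have bounded: "set e \<subseteq> {..n}" if e: "e \<in> ?I" for e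
  proof
    fix v assume "v \<in> set e"
    then obtain i where "i < l" "v = e ! i" using e by (auto simp: in_set_conv_nth inc_seqs_def)
    then have "v \<le> c' ! i" "c' ! i \<in> set c" using e c by auto
    with Suc.prems(3) show "v \<in> {..n}" by auto
  qed
  have sum_le: "sum_list e \<le> sum_list c'" if "e \<in> ?I" for e
  proof -
    have "list_all2 (\<le>) e c'" using that c by (auto simp: list_all2_conv_all_nth inc_seqs_def)
    then show ?thesis by (induction e c' rule: list_all2_induct) auto
  qed
  have IH: "A_kernel t n (rev e) (rev b') = of_int (coeff_A b' e) * (1 - t) ^ (sum_list e - sum_list b')"
    "coeff_A b' e \<noteq> 0 \<Longrightarrow> sum_list b' \<le> sum_list e" if "e \<in> ?I" for e
    using Suc.IH[OF b(2), of e] that bounded[OF that] by auto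
  have "(\<Sum>e\<in>tuples n l. lower t (rev c') e * A_kernel t n e (rev b')) =
      (\<Sum>e\<in>rev ` ?I. lower t (rev c') e * A_kernel t n e (rev b'))"
  proof (rule sum.mono_neutral_right)
    show "rev ` ?I \<subseteq> tuples n l" using bounded rev_inc_seqs_iff by blast
    show "\<forall>e\<in>tuples n l - rev ` ?I. lower t (rev c') e * A_kernel t n e (rev b') = 0"
    proof (rule ballI, rule ccontr)
      fix e assume e: "e \<in> tuples n l - rev ` ?I" "lower t (rev c') e * A_kernel t n e (rev b') \<noteq> 0"
      then have nz: "lower t (rev c') e \<noteq> 0" "A_kernel t n e (rev b') \<noteq> 0" by auto
      have "rev e \<in> inc_seqs l"
        using e A_kernel_nonzero_dec[OF nz(2)] rev_inc_seqs_iff[of "rev e" n l] by simp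
      with lower_nonzero[OF nz(1)] le_iff[of "rev e", unfolded rev_rev_ident] have "rev e \<in> ?I"
        by blast
      then have "e \<in> rev ` ?I" by (rule image_eqI[of e rev "rev e", OF rev_rev_ident[symmetric]])
      with e show False by simp
    qed
  qed simp
  also have "\<dots> = (\<Sum>e\<in>?I. lower t (rev c') (rev e) * A_kernel t n (rev e) (rev b'))"
    by (subst sum.reindex) auto
  also have "\<dots> = (\<Sum>e\<in>?I. of_int (coeff_A b' e) * (1 - t) ^ (sum_list c' - sum_list b'))"
  proof (rule sum.cong[OF refl])
    fix e assume e: "e \<in> ?I"
    have "lower t (rev c') (rev e) = (1 - t) ^ (sum_list c' - sum_list e)"
    proof -
      have "list_all2 (\<le>) (rev e) (rev c')" using e le_iff[of e] by blast
      then show ?thesis by (simp add: lower_eq)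
    qed
    moreover have "sum_list c' - sum_list b' = (sum_list c' - sum_list e) + (sum_list e - sum_list b')"
      if "coeff_A b' e \<noteq> 0" using IH(2)[OF e that] sum_le[OF e] by simp
    ultimately show "lower t (rev c') (rev e) * A_kernel t n (rev e) (rev b') =
        of_int (coeff_A b' e) * (1 - t) ^ (sum_list c' - sum_list b')"
      unfolding IH(1)[OF e] by (cases "coeff_A b' e = 0") (auto simp: power_add)
  qed
  also have "\<dots> = of_int (\<Sum>e\<in>?I. coeff_A b' e) * (1 - t) ^ (sum_list c' - sum_list b')"
    by (simp add: sum_distrib_right)
  finally have sum: "(\<Sum>e\<in>tuples n l. lower t (rev c') e * A_kernel t n e (rev b')) = \<dots>" .
  have A: "coeff_A b c = (if x = z then \<Sum>e\<in>?I. coeff_A b' e else 0)"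
    unfolding b(1) c(1) by (rule coeff_A_snoc[OF b(3) c(3) Suc.hyps])
  have "sum_list b \<le> sum_list c" if "coeff_A b c \<noteq> 0"
  proof -
    from that A have "x = z" "(\<Sum>e\<in>?I. coeff_A b' e) \<noteq> 0" by (auto split: if_splits)
    then obtain e where "e \<in> ?I" "coeff_A b' e \<noteq> 0" by (meson sum.neutral)
    with IH(2) sum_le have "sum_list b' \<le> sum_list c'" using order_trans by blast
    with \<open>x = z\<close> show ?thesis by (simp add: b c)
  qed
  moreover have "A_kernel t n (rev c) (rev b) = of_int (coeff_A b c) * (1 - t) ^ (sum_list c - sum_list b)"
    using dec sum A by (auto simp: b(1) c(1) c(3))
  ultimately show ?case by blast
qed

lemma initial_in_inc_seqs: "[1..<Suc l] \<in> inc_seqs l"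
  by (auto simp: inc_seqs_def simp del: upt_Suc)

lemma inc_seqs_nth_gap:
  assumes "c \<in> inc_seqs l" "i \<le> j" "j < l"
  shows "c ! i + (j - i) \<le> c ! j"
  using assms(2,3)
proof (induction j rule: dec_induct)
  case (step j)
  then have "c ! j < c ! Suc j" using assms(1) by (auto simp: inc_seqs_def sorted_wrt_iff_nth_less)
  with step show ?case by simp
qed simp

lemma inc_seqs_nth_ge:
  assumes "c \<in> inc_seqs l" "i < l"
  shows "Suc i \<le> c ! i"
proof -
  have "c ! 0 \<in> set c" using assms by (intro nth_mem) (auto simp: inc_seqs_def)
  then have "c ! 0 \<noteq> 0" using assms(1) by (metis (lifting) inc_seqs_def mem_Collect_eq)
  with inc_seqs_nth_gap[OF assms(1), of 0 i] assms(2) show ?thesis by simp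
qed

lemma coeff_A_initial:
  assumes "2 \<le> l"
  shows "coeff_A [1..<Suc l] [1..<Suc l] = 1"
  using assms
proof (induction l rule: nat_induct_at_least)
  case base
  show ?case using coeff_A_pair[of 1 2 1 2] by (simp add: numeral_2_eq_2 upt_rec)
next
  case (Suc l)
  have "{c \<in> inc_seqs l. \<forall>i<l. c ! i \<le> [1..<Suc l] ! i} = {[1..<Suc l]}"
    (is "?I = _")
  proof (intro equalityI subsetI)
    fix c assume c: "c \<in> ?I"
    have len: "length c = l" using c by (simp add: inc_seqs_def)
    have "c ! i = Suc i" if "i < l" for i
    proof -
      have "c ! i \<le> [1..<Suc l] ! i" using c that by blast
      moreover have "Suc i \<le> c ! i" using c that inc_seqs_nth_ge by blast
      ultimately show ?thesis using that by (simp del: upt_Suc)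
    qed
    then have "c = [1..<Suc l]"
      using len by (intro nth_equalityI) (auto simp del: upt_Suc)
    then show "c \<in> {[1..<Suc l]}" by simp
  qed (use initial_in_inc_seqs[of l] in \<open>auto simp del: upt_Suc\<close>)
  then show ?case
    using coeff_A_snoc[of "[1..<Suc l]" l "[1..<Suc l]" "Suc l" "Suc l"] Suc by simp
qed

text \<open>An increasing sequence of \<open>l\<close> positive integers with last entry \<open>l\<close> has no gaps.\<close>
lemma coeff_A_initial_support:
  assumes l: "2 \<le> l" and c: "c \<in> inc_seqs l" and nz: "coeff_A [1..<Suc l] c \<noteq> 0"
  shows "c = [1..<Suc l]"
proof (rule nth_equalityI)
  show "length c = length [1..<Suc l]" using c by (simp add: inc_seqs_def)
  fix i assume "i < length c"
  then have i: "i < l" using c by (simp add: inc_seqs_def)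
  have "c ! (l - 1) = l" using coeff_A_last[OF nz] l by (simp add: nth_append)
  moreover have "c ! i + (l - 1 - i) \<le> c ! (l - 1)" using i by (intro inc_seqs_nth_gap[OF c]) auto
  moreover have "Suc i \<le> c ! i" by (rule inc_seqs_nth_ge[OF c i])
  ultimately have "c ! i = Suc i" using i by linarith
  with i show "c ! i = [1..<Suc l] ! i" by (simp del: upt_Suc)
qed

text \<open>Both reversals contribute the same sign.\<close>
lemma det_reverse:
  fixes f :: "nat \<Rightarrow> nat \<Rightarrow> 'a :: comm_ring_1"
  shows "det (mat k k (\<lambda>(i, j). f (k - Suc i) (k - Suc j))) = det (mat k k (\<lambda>(i, j). f i j))"
proof -
  define p where "p i = (if i < k then k - Suc i else i)" for i
  have "bij_betw p {0..<k} {0..<k}"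
    by (rule bij_betw_byWitness[of _ p]) (auto simp: p_def)
  then have p: "p permutes {0..<k}" by (rule bij_imp_permutes) (auto simp: p_def)
  have sq: "signof p * (signof p * x) = (x :: 'a)" for x
    by (simp add: sign_def)
  have "det (mat k k (\<lambda>(i, j). f (k - Suc i) (k - Suc j))) =
      det (mat k k (\<lambda>(i, j). mat k k (\<lambda>(i, j). f i (k - Suc j)) $$ (p i, j)))"
    by (intro arg_cong[where f = det] cong_mat) (auto simp: p_def)
  also have "\<dots> = signof p * det (mat k k (\<lambda>(i, j). f i (k - Suc j)))"
    by (rule det_permute_rows) (use p in auto)
  also have "det (mat k k (\<lambda>(i, j). f i (k - Suc j))) = det (transpose_mat (mat k k (\<lambda>(i, j). f i (k - Suc j))))"
    by (rule det_transpose[symmetric]) auto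
  also have "transpose_mat (mat k k (\<lambda>(i, j). f i (k - Suc j))) =
      mat k k (\<lambda>(i, j). mat k k (\<lambda>(i, j). f j i) $$ (p i, j))"
    by (rule eq_matI) (auto simp: p_def)
  also have "det \<dots> = signof p * det (mat k k (\<lambda>(i, j). f j i))"
    by (rule det_permute_rows) (use p in auto)
  also have "mat k k (\<lambda>(i, j). f j i) = transpose_mat (mat k k (\<lambda>(i, j). f i j))"
    by (rule eq_matI) auto
  also have "det \<dots> = det (mat k k (\<lambda>(i, j). f i j))"
    by (rule det_transpose) auto
  finally show ?thesis by (simp only: sq)
qed

lemma det_gf_eq_column_det:
  assumes "length b = r"
  shows "det_gf Y n m b = column_det (\<lambda>i x. path_gf Y (r - i, n) (m, x)) (rev b)"
proof -
  have "det_gf Y n m b = det (mat r r (\<lambda>(i, j). path_gf Y (start_pts n r ! (r - Suc i)) (end_pts m b ! (r - Suc j))))"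
    unfolding det_gf_def assms by (rule det_reverse[symmetric])
  also have "\<dots> = column_det (\<lambda>i x. path_gf Y (r - i, n) (m, x)) (rev b)"
    unfolding column_det_def length_rev assms
    by (intro arg_cong[where f = det] cong_mat)
      (auto simp: start_pts_def end_pts_def rev_nth Suc_diff_Suc assms simp del: upt_Suc)
  finally show ?thesis .
qed

lemma families_eq_rev_row_families:
  assumes "one_sided_ladder M n Y" "length c = r"
  shows "{Cs. is_family Y (start_pts n r) (end_pts m c) Cs} = rev ` row_families n Y (rev [1..<Suc r]) m (rev c)"
proof -
  have start: "start_pts n r ! i = (Suc i, n)" if "i < r" for i
    using that by (simp add: start_pts_def del: upt_Suc)
  have rstart: "rev [1..<Suc r] ! i = r - i" if "i < r" for i
    using that by (simp add: rev_nth del: upt_Suc)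
  have eq: "is_family Y (start_pts n r) (end_pts m c) (rev Ds) \<longleftrightarrow> Ds \<in> row_families n Y (rev [1..<Suc r]) m (rev c)" for Ds
  proof (cases "length Ds = r")
    case True
    have refl: "(\<forall>i<r. P (r - Suc i)) \<longleftrightarrow> (\<forall>i<r. P i)" for P
    proof (intro iffI allI impI)
      fix i assume *: "\<forall>i<r. P (r - Suc i)" and i: "i < r"
      from *[rule_format, of "r - Suc i"] i show "P i" by simp
    qed simp
    have "(\<forall>i<r. is_path Y (start_pts n r ! i) (end_pts m c ! i) (rev Ds ! i)) \<longleftrightarrow>
        (\<forall>i<r. is_path Y (r - i, n) (m, rev c ! i) (Ds ! i))"
      unfolding refl[symmetric, of "\<lambda>i. is_path Y (start_pts n r ! i) (end_pts m c ! i) (rev Ds ! i)"]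
      using True assms(2) by (simp add: start rev_nth end_pts_def Suc_diff_Suc cong: conj_cong)
    moreover have "(\<forall>i<r. \<forall>j<r. i \<noteq> j \<longrightarrow> rev Ds ! i \<inter> rev Ds ! j = {}) \<longleftrightarrow>
        (\<forall>i j. i < j \<longrightarrow> j < r \<longrightarrow> Ds ! i \<inter> Ds ! j = {})"
    proof
      assume l: "\<forall>i<r. \<forall>j<r. i \<noteq> j \<longrightarrow> rev Ds ! i \<inter> rev Ds ! j = {}"
      show "\<forall>i j. i < j \<longrightarrow> j < r \<longrightarrow> Ds ! i \<inter> Ds ! j = {}"
      proof (intro allI impI)
        fix i j assume "i < j" "j < r"
        with l[rule_format, of "r - Suc i" "r - Suc j"] True show "Ds ! i \<inter> Ds ! j = {}"
          by (simp add: rev_nth)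
      qed
    next
      assume l: "\<forall>i j. i < j \<longrightarrow> j < r \<longrightarrow> Ds ! i \<inter> Ds ! j = {}"
      show "\<forall>i<r. \<forall>j<r. i \<noteq> j \<longrightarrow> rev Ds ! i \<inter> rev Ds ! j = {}"
      proof (intro allI impI)
        fix i j assume ij: "i < r" "j < r" "i \<noteq> j"
        consider "i < j" | "j < i" using ij by linarith
        then show "rev Ds ! i \<inter> rev Ds ! j = {}"
        proof cases
          case 1
          then have "r - Suc j < r - Suc i" "r - Suc i < r" using ij by linarith+
          then have "Ds ! (r - Suc j) \<inter> Ds ! (r - Suc i) = {}" using l by blast
          with ij True show ?thesis by (auto simp: rev_nth)
        next
          case 2
          then have "r - Suc i < r - Suc j" "r - Suc j < r" using ij by linarith+
          then have "Ds ! (r - Suc i) \<inter> Ds ! (r - Suc j) = {}" using l by blast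
          with ij True show ?thesis by (auto simp: rev_nth)
        qed
      qed
    qed
    ultimately show ?thesis
      using True assms by (simp add: is_family_def row_families_def rstart[unfolded One_nat_def] start_pts_def del: upt_Suc)
  next
    case False
    then show ?thesis using assms by (auto simp: is_family_def row_families_def start_pts_def simp del: upt_Suc)
  qed
  show ?thesis
  proof (intro equalityI subsetI)
    fix Cs assume "Cs \<in> {Cs. is_family Y (start_pts n r) (end_pts m c) Cs}"
    with eq[of "rev Cs"] show "Cs \<in> rev ` row_families n Y (rev [1..<Suc r]) m (rev c)"
      by (intro image_eqI[of _ _ "rev Cs"]) (simp_all del: upt_Suc)
  qed (use eq in blast)
qed

lemma family_gf_eq_row_families_gf:
  assumes "one_sided_ladder M n Y" "length c = r"
  shows "family_gf Y n m c = row_families_gf n Y (rev [1..<Suc r]) m (rev c)"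
proof -
  have "family_gf Y n m c = (\<Sum>Cs | is_family Y (start_pts n r) (end_pts m c) Cs. indet ^ (\<Sum>C\<leftarrow>Cs. card (corners C)))"
    using Sum_any_monom_card[of "{Cs. is_family Y (start_pts n r) (end_pts m c) Cs}"
        "\<lambda>Cs. \<Sum>C\<leftarrow>Cs. card (corners C)", OF finite_families[OF finite_ladder[OF assms(1)]]]
    by (simp add: family_gf_def family_count_def assms(2))
  also have "\<dots> = row_families_gf n Y (rev [1..<Suc r]) m (rev c)"
    unfolding families_eq_rev_row_families[OF assms] row_families_gf_def[OF assms(1)]
    by (subst sum.reindex) (auto simp: rev_map[symmetric] sum_list_rev simp del: upt_Suc)
  finally show ?thesis .
qed

text \<open>The theorem as an identity of polynomials, with the power of \<open>t\<close> on the other side.\<close>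
lemma det_gf_expansion:
  assumes "2 \<le> r" and ladder: "one_sided_ladder M n Y" and b: "b \<in> inc_seqs r"
    and start: "(r, n) \<in> Y" and rm: "r \<le> m" and bn: "set b \<subseteq> {..n}"
  shows "det_gf Y n m b = indet ^ (r choose 2) * (\<Sum>c\<in>{c \<in> inc_seqs r. coeff_A b c \<noteq> 0}.
    of_int (coeff_A b c) * (1 - indet) ^ (sum_list c - sum_list b) * family_gf Y n m c)"
proof -
  let ?S = "{c \<in> inc_seqs r. coeff_A b c \<noteq> 0}"
  let ?F = "row_families_gf n Y (rev [1..<Suc r]) m"
  have lb: "length b = r" using b by (simp add: inc_seqs_def)
  have rb: "rev b \<in> tuples n r" "dec (rev b)" using b bn rev_inc_seqs_iff by blast+
  have "b ! (r - 1) \<in> set b" using lb assms(1) by (intro nth_mem) simp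
  then have last: "b ! (r - 1) \<le> n" using bn by blast
  have S: "set c \<subseteq> {..n}" if c: "c \<in> ?S" for c
  proof
    fix v assume "v \<in> set c"
    then obtain i where i: "i < r" "v = c ! i" using c by (auto simp: in_set_conv_nth inc_seqs_def)
    have "c ! i + (r - 1 - i) \<le> c ! (r - 1)"
      using c i by (intro inc_seqs_nth_gap[of c r]) auto
    then have "v \<le> c ! (r - 1)" using i by simp
    also have "c ! (r - 1) = b ! (r - 1)" using coeff_A_last[of b c] c lb by simp
    also have "\<dots> \<le> n" using last by blast
    finally show "v \<in> {..n}" by simp
  qed
  have "(\<Sum>e\<in>tuples n r. ?F e * A_kernel indet n e (rev b)) = (\<Sum>e\<in>rev ` ?S. ?F e * A_kernel indet n e (rev b))"
  proof (rule sum.mono_neutral_right)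
    show "rev ` ?S \<subseteq> tuples n r" using S rev_inc_seqs_iff by blast
    show "\<forall>e\<in>tuples n r - rev ` ?S. ?F e * A_kernel indet n e (rev b) = 0"
    proof (rule ballI, rule ccontr)
      fix e assume e: "e \<in> tuples n r - rev ` ?S" "?F e * A_kernel indet n e (rev b) \<noteq> 0"
      then have nz: "A_kernel indet n e (rev b) \<noteq> 0" by auto
      have re: "rev e \<in> inc_seqs r" "set (rev e) \<subseteq> {..n}"
        using e A_kernel_nonzero_dec[OF nz] rev_inc_seqs_iff[of "rev e" n r] by simp_all
      have "coeff_A b (rev e) \<noteq> 0"
        using A_kernel_eq_coeff_A[OF assms(1) b re, of indet] nz by auto
      with re have "rev e \<in> ?S" by blast
      then have "e \<in> rev ` ?S" by (rule image_eqI[of e rev "rev e", OF rev_rev_ident[symmetric]])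
      with e show False by simp
    qed
  qed simp
  also have "\<dots> = (\<Sum>c\<in>?S. ?F (rev c) * A_kernel indet n (rev c) (rev b))"
    by (subst sum.reindex) auto
  also have "\<dots> = (\<Sum>c\<in>?S. of_int (coeff_A b c) * (1 - indet) ^ (sum_list c - sum_list b) * family_gf Y n m c)"
  proof (rule sum.cong[OF refl])
    fix c assume c: "c \<in> ?S"
    then have "length c = r" by (simp add: inc_seqs_def)
    with c show "?F (rev c) * A_kernel indet n (rev c) (rev b) =
        of_int (coeff_A b c) * (1 - indet) ^ (sum_list c - sum_list b) * family_gf Y n m c"
      using A_kernel_eq_coeff_A[OF assms(1) b _ S[OF c], of indet] family_gf_eq_row_families_gf[OF ladder, of c r m]
      by (simp add: mult_ac del: upt_Suc)
  qed
  finally show ?thesis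
    using column_det_path_gf[OF ladder start rb, of "m - r"] rm det_gf_eq_column_det[OF lb, of Y n m] by simp
qed

theorem theorem1p2:
  fixes m n r :: nat and Y :: "(nat \<times> nat) set" and b :: "nat list"
  assumes "m \<ge> 1" and "n \<ge> 1" and "r \<ge> 2"
    and "one_sided_ladder m n Y"
    and "b \<in> inc_seqs r"
    and "\<forall>i\<in>{1..r}. (i, n) \<in> Y"
    and "\<forall>i<r. (m, b ! i) \<in> Y"
  shows "tvar powi (- int (r choose 2)) * to_fract (det_gf Y n m b) =
           (\<Sum>c \<in> {c \<in> inc_seqs r. coeff_A b c \<noteq> 0}.
              of_int (coeff_A b c) * (1 - tvar) powi (\<Sum>i<r. int (c ! i) - int (b ! i)) *
              to_fract (family_gf Y n m c))
       \<and> ((\<forall>i<r. b ! i = i + 1) \<longrightarrow>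
           tvar powi (- int (r choose 2)) * to_fract (det_gf Y n m [1..<Suc r]) =
             to_fract (family_gf Y n m [1..<Suc r]))"
proof -
  let ?S = "{c \<in> inc_seqs r. coeff_A b c \<noteq> 0}"
  have lb: "length b = r" using assms(5) by (simp add: inc_seqs_def)
  have start: "(r, n) \<in> Y" using assms(3,6) by simp
  have rm: "r \<le> m" using ladder_bounds[OF assms(4) start] by simp
  have bn: "set b \<subseteq> {..n}"
    using assms(7) ladder_bounds[OF assms(4)] lb by (fastforce simp: in_set_conv_nth)
  have tvar: "tvar = to_fract indet" by (simp add: tvar_def indet_def)
  have "indet \<noteq> 0" by (simp add: indet_def)
  then have "tvar \<noteq> 0" by (simp add: tvar)
  have hom_power: "to_fract (p ^ k) = to_fract p ^ k" for p :: "int poly" and k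
    by (induction k) auto
  have hom_int: "to_fract (of_int k :: int poly) = of_int k" for k
  proof (induction k rule: int_induct[of _ 0])
    case (step1 i)
    then show ?case by (simp only: of_int_add to_fract_add of_int_1 to_fract_1)
  next
    case (step2 i)
    then show ?case by (simp only: of_int_diff to_fract_diff of_int_1 to_fract_1)
  qed simp
  have cancel: "tvar powi (- int (r choose 2)) * (tvar ^ (r choose 2) * x) = x" for x
    using \<open>tvar \<noteq> 0\<close> by (simp add: power_int_minus field_simps)
  have expo: "(1 - tvar) powi (\<Sum>i<r. int (c ! i) - int (b ! i)) = to_fract ((1 - indet) ^ (sum_list c - sum_list b))"
    if c: "c \<in> ?S" for c
  proof -
    have lc: "length c = r" using c by (simp add: inc_seqs_def)
    have cn: "c \<in> inc_seqs r" "set c \<subseteq> {..Max (set c)}" using c by auto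
    \<comment> \<open>only the inequality between the sums is used, so any ring element can serve as \<open>t\<close>\<close>
    have le: "sum_list b \<le> sum_list c"
      using A_kernel_eq_coeff_A[OF assms(3,5) cn, of "0 :: int"] c by simp
    have "(\<Sum>i<r. int (c ! i) - int (b ! i)) = int (sum_list c) - int (sum_list b)"
      using sum_list_map_nth[OF lb, of "\<lambda>x. x"] sum_list_map_nth[OF lc, of "\<lambda>x. x"]
      by (simp add: sum_subtractf)
    also have "\<dots> = int (sum_list c - sum_list b)" using le by simp
    finally show ?thesis by (simp only: power_int_of_nat hom_power tvar to_fract_diff to_fract_1)
  qed
  have "to_fract (det_gf Y n m b) = tvar ^ (r choose 2) * (\<Sum>c\<in>?S. of_int (coeff_A b c) *
      (1 - tvar) powi (\<Sum>i<r. int (c ! i) - int (b ! i)) * to_fract (family_gf Y n m c))"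
    unfolding det_gf_expansion[OF assms(3,4,5) start rm bn] to_fract_mult to_fract_sum hom_power tvar[symmetric]
    by (intro arg_cong[where f = "\<lambda>s. _ * s"] sum.cong refl) (simp only: expo[unfolded tvar] hom_int hom_power tvar to_fract_diff to_fract_1)
  then have main: "tvar powi (- int (r choose 2)) * to_fract (det_gf Y n m b) =
      (\<Sum>c\<in>?S. of_int (coeff_A b c) *
      (1 - tvar) powi (\<Sum>i<r. int (c ! i) - int (b ! i)) * to_fract (family_gf Y n m c))"
    by (simp only: cancel)
  have "tvar powi (- int (r choose 2)) * to_fract (det_gf Y n m [1..<Suc r]) =
      to_fract (family_gf Y n m [1..<Suc r])" if "\<forall>i<r. b ! i = i + 1"
  proof -
    have b: "b = [1..<Suc r]"
      using that lb by (intro nth_equalityI) (auto simp del: upt_Suc)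
    have "?S = {b}"
      using coeff_A_initial_support[OF assms(3)] coeff_A_initial[OF assms(3)] assms(5) unfolding b by auto
    then show ?thesis
      using main coeff_A_initial[OF assms(3)] unfolding b[symmetric] by simp
  qed
  with main show ?thesis by blast
qed

end
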